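(* Let $(W,Y)$ and $(W',Y')$ be random vectors on a common probability space satisfying the following. (I) $\mathbb{E}W=0$, $\operatorname{Var}(W)=1$; $\mathbb{E}Y=0$, $\operatorname{Var}(Y)=\sigma_Y^2$; $W$ and $Y$ are uncorrelated; and $(W,Y,W',Y')\overset{d}{=}(W',Y',W,Y)$ (exchangeability). (II) $Y$ takes values in $\zeta+\mathbb{Z}$ for some $\zeta\in[0,1)$, $\Delta Y:=Y'-Y\in\{-1,0,1\}$ almost surely, and $M_{0,\pm}(W,Y)=Q+R_{0,\pm}$, where $Q=\lambda\sigma_Y^2$ for some $\lambda\in(0,1)$ and $R_{0,\pm}$ are random variables. (III) $M_{1,\pm}(W,Y)=-\lambda\left(\tfrac12\psi W+R_{1,\pm}\right)$ for some number $\psi>0$ and random variables $R_{1,\pm}$. (IV) $M_{2,\pm}(W,Y)=\lambda(\psi+R_{2,\pm})$ for random variables $R_{2,\pm}$. Let $k$ be such that $p_k:=\mathbb{P}(Y=k)>0$. Then $$d_W\big((W\mid Y=k),Z\big)\le \frac{2}{\psi}\Big(A_k+\frac{1}{p_k}C\Big)+\sqrt{\frac{2}{\pi\psi^2}}\Big(B_k+\frac1{p_k}D\Big)+\frac{2}{3\lambda\psi p_k}\,\mathbb{E}|\Delta W|^3,$$ where $A_k=\mathbb{E}(|R_{1,-}|\mid Y=k)$, $B_k=\mathbb{E}(|R_{2,-}|\mid Y=k)$, $C=\mathbb{E}|R_{1,+}-R_{1,-}|$, $D=\mathbb{E}|R_{2,+}-R_{2,-}|$, and $Z$ is a standard normal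 random variable.
   Context: $\Delta W:=W'-W$. For $\ell\ge0$, $M_{\ell,\pm}(W,Y):=\mathbb{E}\big((\Delta W)^\ell\,\mathbf{1}_{\{\Delta Y=\pm1\}}\mid W,Y\big)$ (the "+" and "−" versions being two separate quantities; in particular $M_{0,\pm}=\mathbb{P}(\Delta Y=\pm1\mid W,Y)$). For a random variable $V$ and event $B$ of positive probability, $d_W((V\mid B),Z):=\sup_h|\mathbb{E}(h(V)\mid B)-\mathbb{E}h(Z)|$, the supremum over all $1$-Lipschitz $h:\mathbb{R}\to\mathbb{R}$ (Wasserstein-1 distance). *)

theory Defs
  imports "HOL-Probability.Probability"
begin

definition sigma_WY :: "'a measure \<Rightarrow> ('a \<Rightarrow> real) \<Rightarrow> ('a \<Rightarrow> real) \<Rightarrow> 'a measure" where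
  "sigma_WY M W Y = vimage_algebra (space M) (\<lambda>\<omega>. (W \<omega>, Y \<omega>)) borel"

definition Mcond :: "'a measure \<Rightarrow> ('a \<Rightarrow> real) \<Rightarrow> ('a \<Rightarrow> real) \<Rightarrow> ('a \<Rightarrow> real) \<Rightarrow> ('a \<Rightarrow> real)
    \<Rightarrow> nat \<Rightarrow> real \<Rightarrow> 'a \<Rightarrow> real" where
  "Mcond M W Y W' Y' l s = real_cond_exp M (sigma_WY M W Y)
     (\<lambda>\<omega>. (W' \<omega> - W \<omega>) ^ l * (if Y' \<omega> - Y \<omega> = s then 1 else 0))"

definition cond_exp_event :: "'a measure \<Rightarrow> ('a \<Rightarrow> real) \<Rightarrow> 'a set \<Rightarrow> real" where
  "cond_exp_event M X B = (\<integral>\<omega>. X \<omega> * indicator B \<omega> \<partial>M) / measure M B"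

definition lipschitz1 :: "(real \<Rightarrow> real) \<Rightarrow> bool" where
  "lipschitz1 h \<longleftrightarrow> (\<forall>x y. \<bar>h x - h y\<bar> \<le> \<bar>x - y\<bar>)"

definition dW_cond_normal :: "'a measure \<Rightarrow> ('a \<Rightarrow> real) \<Rightarrow> 'a set \<Rightarrow> ennreal" where
  "dW_cond_normal M V B = (SUP h \<in> {h. lipschitz1 h}.
     ennreal \<bar>cond_exp_event M (\<lambda>\<omega>. h (V \<omega>)) B
              - (\<integral>x. std_normal_density x * h x \<partial>lborel)\<bar>)"

end

theory Submission
  imports Defs "HOL-Real_Asymp.Real_Asymp"
begin

text \<open>
  Let \<open>f\<close> solve Stein's equation \<open>f' x - x * f x = h x - E h(Z)\<close> for a 1-Lipschitz \<open>h\<close>, let \<open>G' = f\<close>, and let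
  \<open>flow G j s = E (G(W') - G(W); Y = j, Y' - Y = s)\<close>. Since \<open>f\<close>, \<open>f'\<close> and the Lipschitz constant of \<open>f'\<close> are
  bounded by \<open>1\<close>, \<open>sqrt (2/pi)\<close> and \<open>2\<close>, a Taylor expansion of \<open>G\<close> with conditions (III) and (IV) gives
  \<open>2 * flow G k (-1) = lam * psi * E (f'(W) - W f(W); Y = k)\<close> up to the error terms at \<open>k\<close>. Exchangeability
  gives \<open>flow G j (-1) = - flow G (j - 1) 1\<close>, and the same expansion shows that \<open>flow G j 1 - flow G j (-1)\<close> only
  involves the differences \<open>R1p - R1m\<close>, \<open>R2p - R2m\<close> and third moments on \<open>{Y = j}\<close>. Alternating the two
  relations downwards from \<open>k\<close>, where the flow tends to \<open>0\<close>, bounds \<open>flow G k (-1)\<close> by errors on the disjoint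
  events \<open>{Y = j}\<close>, \<open>j < k\<close>.
\<close>

section \<open>Calculus on the real line\<close>

lemma DERIV_zero_tendsto_imp_eq:
  fixes f :: "real \<Rightarrow> real"
  assumes deriv: "\<And>x. (f has_real_derivative 0) (at x)" and lim: "(f \<longlongrightarrow> l) F" and "F \<noteq> bot"
  shows "f x = l"
proof -
  have "f y = f x" for y
    using deriv by (blast intro: DERIV_isconst_all)
  then have "(f \<longlongrightarrow> f x) F"
    by (intro tendsto_eventually always_eventually) blast
  then show ?thesis
    using lim \<open>F \<noteq> bot\<close> by (blast intro: tendsto_unique)
qed

lemma DERIV_nonneg_tendsto_at_bot_imp_le:
  fixes f f' :: "real \<Rightarrow> real"
  assumes deriv: "\<And>x. (f has_real_derivative f' x) (at x)" and nonneg: "\<And>x. f' x \<ge> 0"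
    and lim: "(f \<longlongrightarrow> l) at_bot"
  shows "l \<le> f x"
proof (rule tendsto_upperbound[OF lim])
  have "f y \<le> f x" if "y \<le> x" for y
    by (rule DERIV_nonneg_imp_nondecreasing[OF that]) (use deriv nonneg in blast)
  then show "\<forall>\<^sub>F y in at_bot. f y \<le> f x"
    by (rule eventually_mono[OF eventually_le_at_bot[of x]])
qed simp

lemma DERIV_unimodal_imp_nonneg:
  fixes f f' l u :: "real \<Rightarrow> real"
  assumes deriv: "\<And>x. 0 < x \<Longrightarrow> (f has_real_derivative f' x) (at x)"
    and unimodal: "\<And>x y. 0 < x \<Longrightarrow> x \<le> y \<Longrightarrow> 0 \<le> f' y \<Longrightarrow> 0 \<le> f' x"
    and at_0: "(l \<longlongrightarrow> 0) (at_right 0)" "\<And>x. 0 < x \<Longrightarrow> l x \<le> f x"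
    and at_infinity: "(u \<longlongrightarrow> 0) at_top" "\<And>x. 0 < x \<Longrightarrow> u x \<le> f x"
    and "0 < x"
  shows "0 \<le> f x"
proof (cases "0 \<le> f' x")
  case True
  have "l y \<le> f x" if "0 < y" "y < x" for y
  proof -
    have "f y \<le> f x"
    proof (rule DERIV_nonneg_imp_nondecreasing[OF less_imp_le[OF \<open>y < x\<close>]])
      fix z assume "y \<le> z" "z \<le> x"
      then show "\<exists>d. (f has_real_derivative d) (at z) \<and> 0 \<le> d"
        using deriv[of z] unimodal[of z x] True \<open>0 < y\<close> by auto
    qed
    then show ?thesis using at_0(2)[OF \<open>0 < y\<close>] by simp
  qed
  then have "\<forall>\<^sub>F y in at_right 0. l y \<le> f x"
    using eventually_at_right_real[OF \<open>0 < x\<close>] by (auto elim!: eventually_mono)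
  with at_0(1) show ?thesis by (rule tendsto_upperbound) simp
next
  case False
  have "u y \<le> f x" if "x \<le> y" for y
  proof -
    have "f y \<le> f x"
    proof (rule DERIV_nonpos_imp_nonincreasing[OF \<open>x \<le> y\<close>])
      fix z assume "x \<le> z" "z \<le> y"
      then show "\<exists>d. (f has_real_derivative d) (at z) \<and> d \<le> 0"
        using deriv[of z] unimodal[of x z] False \<open>0 < x\<close> by (metis linear order_less_le_trans)
    qed
    then show ?thesis using at_infinity(2)[of y] \<open>0 < x\<close> that by simp
  qed
  then have "\<forall>\<^sub>F y in at_top. u y \<le> f x"
    by (rule eventually_at_top_linorderI)
  with at_infinity(1) show ?thesis by (rule tendsto_upperbound) simp
qed

lemma abs_le_power_of_DERIV_le:
  fixes r r' :: "real \<Rightarrow> real"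
  assumes deriv: "\<And>t. (r has_real_derivative r' t) (at t)" and "r x = 0"
    and bound: "\<And>t. \<bar>r' t\<bar> \<le> C * real (Suc n) * \<bar>t - x\<bar> ^ n"
  shows "\<bar>r y\<bar> \<le> C * \<bar>y - x\<bar> ^ Suc n"
proof -
  define d p where "d = y - x" and "p = (\<lambda>s. x + s * d)"
  have p_deriv: "((\<lambda>s. r (p s)) has_real_derivative r' (p s) * d) (at s)" for s
    unfolding p_def by (rule DERIV_chain2[OF deriv]) (auto intro!: derivative_eq_intros)
  have "norm (r (p 1) - r (p 0)) \<le> C * \<bar>d\<bar> ^ Suc n * 1 ^ Suc n - C * \<bar>d\<bar> ^ Suc n * 0 ^ Suc n"
  proof (rule differentiable_bound_general[where f' = "\<lambda>s. r' (p s) * d"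
        and \<phi>' = "\<lambda>s. C * \<bar>d\<bar> ^ Suc n * (real (Suc n) * s ^ n)"])
    show "continuous_on {0..1} (\<lambda>s. r (p s))"
      using p_deriv by (intro continuous_at_imp_continuous_on) (blast intro: DERIV_isCont)
    show "((\<lambda>s. r (p s)) has_vector_derivative r' (p s) * d) (at s)" for s
      using p_deriv by (simp add: has_real_derivative_iff_has_vector_derivative)
    show "((\<lambda>s. C * \<bar>d\<bar> ^ Suc n * s ^ Suc n) has_vector_derivative
        C * \<bar>d\<bar> ^ Suc n * (real (Suc n) * s ^ n)) (at s)" for s
      unfolding has_real_derivative_iff_has_vector_derivative[symmetric]
      by (auto intro!: derivative_eq_intros simp del: power_Suc)
    show "norm (r' (p s) * d) \<le> C * \<bar>d\<bar> ^ Suc n * (real (Suc n) * s ^ n)" if "0 < s" for s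
      using mult_right_mono[OF bound[of "p s"], of "\<bar>d\<bar>"] that
      by (simp add: p_def abs_mult power_mult_distrib mult_ac)
  qed (auto intro!: continuous_intros)
  then show ?thesis
    using \<open>r x = 0\<close> by (simp add: p_def d_def)
qed

lemma taylor_2_lipschitz:
  fixes f f' G :: "real \<Rightarrow> real"
  assumes G: "\<And>x. (G has_real_derivative f x) (at x)" and f: "\<And>x. (f has_real_derivative f' x) (at x)"
    and lip: "L-lipschitz_on UNIV f'"
  shows "\<bar>G y - G x - f x * (y - x) - f' x * (y - x)\<^sup>2 / 2\<bar> \<le> L / 6 * \<bar>y - x\<bar> ^ 3"
proof -
  have first_order: "\<bar>f t - f x - f' x * (t - x)\<bar> \<le> L / 2 * \<bar>t - x\<bar> ^ Suc 1" for t
    by (rule abs_le_power_of_DERIV_le[where r' = "\<lambda>t. f' t - f' x"])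
       (use f lipschitz_onD[OF lip] in \<open>auto intro!: derivative_eq_intros simp: dist_real_def\<close>)
  have "\<bar>G y - G x - f x * (y - x) - f' x * (y - x)\<^sup>2 / 2\<bar> \<le> L / 6 * \<bar>y - x\<bar> ^ Suc 2"
    by (rule abs_le_power_of_DERIV_le[where r' = "\<lambda>t. f t - f x - f' x * (t - x)"])
       (use G first_order in \<open>auto intro!: derivative_eq_intros simp: power2_eq_square\<close>)
  then show ?thesis by (simp add: numeral_3_eq_3)
qed

lemma continuous_antiderivative:
  fixes f :: "real \<Rightarrow> real"
  assumes "continuous_on UNIV f"
  obtains G where "\<And>x. (G has_real_derivative f x) (at x)"
  using einterval_antiderivative[of "- \<infinity>" "\<infinity>" f] assms
  by (auto simp: continuous_on_eq_continuous_at has_real_derivative_iff_has_vector_derivative)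

section \<open>Integrals\<close>

lemma integrable_imp_set_integrable:
  fixes f :: "'a \<Rightarrow> 'b::{banach, second_countable_topology}"
  assumes "integrable M f" "A \<in> sets M"
  shows "set_integrable M A f"
  using assms unfolding set_integrable_def by (intro integrable_mult_indicator)

lemma set_integral_abs_le:
  fixes f g :: "'a \<Rightarrow> real"
  assumes f: "integrable M f" and g: "integrable M g" and A: "A \<in> sets M"
    and le: "\<And>x. x \<in> A \<Longrightarrow> \<bar>f x\<bar> \<le> g x"
  shows "\<bar>LINT x:A|M. f x\<bar> \<le> (LINT x:A|M. g x)"
proof -
  have "\<bar>LINT x:A|M. f x\<bar> \<le> (LINT x:A|M. \<bar>f x\<bar>)"
    using set_integral_norm_bound[OF integrable_imp_set_integrable[OF f A]] by simp
  also have "\<dots> \<le> (LINT x:A|M. g x)"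
    using f g A le by (intro set_integral_mono integrable_imp_set_integrable) auto
  finally show ?thesis .
qed

lemma set_integral_mono_set:
  fixes f :: "'a \<Rightarrow> real"
  assumes "integrable M f" "A \<in> sets M" "B \<in> sets M" "A \<subseteq> B" "\<And>x. x \<in> B \<Longrightarrow> 0 \<le> f x"
  shows "(LINT x:A|M. f x) \<le> (LINT x:B|M. f x)"
  unfolding set_lebesgue_integral_def using assms
  by (intro integral_mono integrable_mult_indicator) (auto simp: indicator_def)

lemma integrable_bounded_mult:
  fixes f g :: "'a \<Rightarrow> real"
  assumes g: "integrable M g" and f: "f \<in> borel_measurable M" "\<And>x. \<bar>f x\<bar> \<le> B"
  shows "integrable M (\<lambda>x. f x * g x)"
proof (rule Bochner_Integration.integrable_bound)
  show "integrable M (\<lambda>x. B * g x)" using g by (rule integrable_mult_right)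
  have "\<bar>f x\<bar> * \<bar>g x\<bar> \<le> \<bar>B\<bar> * \<bar>g x\<bar>" for x
    using f(2)[of x] by (intro mult_right_mono) auto
  then show "AE x in M. norm (f x * g x) \<le> norm (B * g x)"
    by (simp add: abs_mult)
qed (use f g in measurable)

lemma set_integral_atMost_add_greaterThan:
  fixes f :: "real \<Rightarrow> 'b::{banach, second_countable_topology}"
  assumes "sets M = sets borel" "integrable M f"
  shows "(LINT z:{..x}|M. f z) + (LINT z:{x<..}|M. f z) = integral\<^sup>L M f"
proof -
  have "{..x} \<union> {x<..} = space M"
    using sets_eq_imp_space_eq[OF assms(1)] by auto
  then show ?thesis
    using assms
    by (subst set_integral_Un[symmetric])
       (auto intro!: integrable_imp_set_integrable simp: set_integral_space)
qed

lemma set_integral_escaping_tendsto_0: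
  fixes f :: "'a \<Rightarrow> 'b::{banach, second_countable_topology}"
  assumes f: "integrable M f" and A: "\<And>n. A n \<in> sets M"
    and escaping: "\<And>x. \<forall>\<^sub>F n in sequentially. x \<notin> A n"
  shows "(\<lambda>n. LINT x:A n|M. f x) \<longlonglongrightarrow> 0"
proof -
  have "(\<lambda>n. \<integral>x. indicat_real (A n) x *\<^sub>R f x \<partial>M) \<longlonglongrightarrow> (\<integral>x. 0 \<partial>M)"
  proof (rule integral_dominated_convergence[where w = "\<lambda>x. norm (f x)"])
    have "\<forall>\<^sub>F n in sequentially. indicat_real (A n) x *\<^sub>R f x = 0" for x
      using escaping[of x] by eventually_elim simp
    then show "AE x in M. (\<lambda>n. indicat_real (A n) x *\<^sub>R f x) \<longlonglongrightarrow> 0"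
      by (intro AE_I2 tendsto_eventually)
    show "AE x in M. norm (indicat_real (A n) x *\<^sub>R f x) \<le> norm (f x)" for n
      by (auto simp: indicator_def)
    show "(\<lambda>x. indicat_real (A n) x *\<^sub>R f x) \<in> borel_measurable M" for n
      using f A by (intro borel_measurable_scaleR borel_measurable_indicator) auto
  qed (use f in auto)
  then show ?thesis
    by (simp add: set_lebesgue_integral_def)
qed

lemma set_integral_atMost_tendsto_at_bot:
  fixes f :: "real \<Rightarrow> 'b::{banach, second_countable_topology}"
  assumes "sets M = sets borel" "integrable M f"
  shows "((\<lambda>x. LINT z:{..x}|M. f z) \<longlongrightarrow> 0) at_bot"
proof (rule tendsto_at_botI_sequentially)
  fix X :: "nat \<Rightarrow> real" assume "filterlim X at_bot sequentially"
  then have "\<forall>\<^sub>F n in sequentially. z \<notin> {..X n}" for z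
    by (simp add: filterlim_at_bot_dense not_le)
  then show "(\<lambda>n. LINT z:{..X n}|M. f z) \<longlonglongrightarrow> 0"
    using assms by (intro set_integral_escaping_tendsto_0) auto
qed

lemma set_integral_atMost_has_real_derivative:
  fixes f :: "real \<Rightarrow> real"
  assumes f: "integrable lborel f" and cont: "isCont f x"
  shows "((\<lambda>y. LINT z:{..y}|lborel. f z) has_real_derivative f x) (at x)"
proof (rule has_field_derivative_transform_within_open[where S = "{x - 1<..}"])
  have int: "set_integrable lborel A f" if "A \<in> sets borel" for A
    using f that by (intro integrable_imp_set_integrable) auto
  have "((\<lambda>y. integral {x - 1..y} f) has_vector_derivative f x) (at x within {x - 1..x + 1} - {})"
    using cont int
    by (intro integral_has_vector_derivative_continuous_at set_borel_integral_eq_integral(1))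
       (auto intro: continuous_at_imp_continuous_at_within)
  then have "((\<lambda>y. integral {x - 1..y} f) has_real_derivative f x) (at x)"
    by (simp add: at_within_Icc_at has_real_derivative_iff_has_vector_derivative)
  then show "((\<lambda>y. (LINT z:{..x - 1}|lborel. f z) + integral {x - 1..y} f) has_real_derivative f x) (at x)"
    by (auto intro!: derivative_eq_intros)
  fix y assume y: "y \<in> {x - 1<..}"
  then have "{..y} = {..x - 1} \<union> {x - 1<..y}" by auto
  then have "(LINT z:{..y}|lborel. f z) = (LINT z:{..x - 1}|lborel. f z) + (LINT z:{x - 1<..y}|lborel. f z)"
    by (simp only:) (rule set_integral_Un; auto intro!: int)
  also have "(LINT z:{x - 1<..y}|lborel. f z) = (LINT z:{x - 1..y}|lborel. f z)"
    by (rule set_integral_discrete_difference[where X = "{x - 1}"]) auto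
  also have "\<dots> = integral {x - 1..y} f"
    by (intro set_borel_integral_eq_integral int) simp
  finally show "(LINT z:{..x - 1}|lborel. f z) + integral {x - 1..y} f = (LINT z:{..y}|lborel. f z)" ..
qed auto

lemma (in finite_measure) integrable_lipschitz_on_compose:
  fixes h X :: "_ \<Rightarrow> real"
  assumes h: "C-lipschitz_on UNIV h" and X: "integrable M X"
  shows "integrable M (\<lambda>\<omega>. h (X \<omega>))"
proof (rule Bochner_Integration.integrable_bound)
  show "integrable M (\<lambda>\<omega>. \<bar>h 0\<bar> + C * \<bar>X \<omega>\<bar>)"
    using X by simp
  have "h \<in> borel_measurable borel"
    using lipschitz_on_continuous_on[OF h] by (rule borel_measurable_continuous_onI)
  then show "(\<lambda>\<omega>. h (X \<omega>)) \<in> borel_measurable M"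
    using X by measurable
  have "\<bar>h x\<bar> \<le> \<bar>h 0\<bar> + C * \<bar>x\<bar>" for x
    using lipschitz_onD[OF h, of x 0] by (simp add: dist_real_def)
  then show "AE \<omega> in M. norm (h (X \<omega>)) \<le> norm (\<bar>h 0\<bar> + C * \<bar>X \<omega>\<bar>)"
    by (auto intro: order_trans[OF _ abs_ge_self])
qed

section \<open>The standard normal distribution\<close>

interpretation std_normal: real_distribution std_normal_distribution
  by (rule real_dist_normal_dist)

abbreviation std_normal_cdf :: "real \<Rightarrow> real" where
  "std_normal_cdf \<equiv> cdf std_normal_distribution"

abbreviation std_normal_mean :: "(real \<Rightarrow> real) \<Rightarrow> real" where
  "std_normal_mean h \<equiv> integral\<^sup>L std_normal_distribution h"

lemma measure_std_normal_UNIV [simp]: "measure std_normal_distribution UNIV = 1"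
  using std_normal.prob_space by simp

lemma std_normal_density_pos: "std_normal_density x > 0"
  by (simp add: normal_density_pos)

lemma std_normal_density_minus: "std_normal_density (- x) = std_normal_density x"
  by (simp add: std_normal_density_def)

lemma std_normal_density_has_derivative [derivative_intros]:
  "(std_normal_density has_real_derivative - x * std_normal_density x) (at x)"
  unfolding std_normal_density_def by (auto intro!: derivative_eq_intros simp: field_simps)

lemma std_normal_density_tendsto_at_bot: "(std_normal_density \<longlongrightarrow> 0) at_bot"
  unfolding std_normal_density_def by real_asymp

lemma set_integral_std_normal:
  fixes f :: "real \<Rightarrow> real"
  assumes "f \<in> borel_measurable borel" "A \<in> sets borel"
  shows "(LINT z:A|std_normal_distribution. f z) = (LINT z:A|lborel. std_normal_density z * f z)"
  using assms unfolding set_lebesgue_integral_def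
  by (subst integral_density) (auto simp: normal_density_nonneg mult_ac)

lemma set_integral_std_normal_has_derivative:
  assumes f: "integrable std_normal_distribution f" and "isCont f x"
  shows "((\<lambda>y. LINT z:{..y}|std_normal_distribution. f z) has_real_derivative std_normal_density x * f x) (at x)"
proof -
  have f_meas: "f \<in> borel_measurable borel"
    using borel_measurable_integrable[OF f] by simp
  have "integrable lborel (\<lambda>z. std_normal_density z * f z)"
    using f f_meas by (simp add: integrable_density normal_density_nonneg)
  moreover have "isCont (\<lambda>z. std_normal_density z * f z) x"
    using DERIV_isCont[OF std_normal_density_has_derivative] \<open>isCont f x\<close> by (intro continuous_intros)
  ultimately show ?thesis
    using f_meas set_integral_atMost_has_real_derivative[of "\<lambda>z. std_normal_density z * f z" x]
    by (simp add: set_integral_std_normal)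
qed

lemma set_integral_std_normal_const:
  "(LINT z:{..x}|std_normal_distribution. c) = c * std_normal_cdf x"
  "(LINT z:{x<..}|std_normal_distribution. c) = c * (1 - std_normal_cdf x)"
proof -
  show "(LINT z:{..x}|std_normal_distribution. c) = c * std_normal_cdf x"
    by (subst set_integral_const) (auto simp: cdf_def)
  then show "(LINT z:{x<..}|std_normal_distribution. c) = c * (1 - std_normal_cdf x)"
    using set_integral_atMost_add_greaterThan[of std_normal_distribution "\<lambda>_. c" x]
    by (simp add: algebra_simps)
qed

lemma std_normal_cdf_has_derivative [derivative_intros]:
  "(std_normal_cdf has_real_derivative std_normal_density x) (at x)"
  using set_integral_std_normal_has_derivative[of "\<lambda>_. 1" x]
  by (simp add: set_integral_std_normal_const)

lemma std_normal_cdf_minus: "std_normal_cdf (- x) = 1 - std_normal_cdf x"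
proof -
  have "std_normal_cdf x + std_normal_cdf (- x) = 1"
  proof (rule DERIV_zero_tendsto_imp_eq[where f = "\<lambda>x. std_normal_cdf x + std_normal_cdf (- x)"])
    have "((\<lambda>x. std_normal_cdf (- x)) has_real_derivative - std_normal_density x) (at x)" for x
      using std_normal_cdf_has_derivative[of "- x"] unfolding DERIV_mirror std_normal_density_minus .
    from DERIV_add[OF std_normal_cdf_has_derivative this]
    show "((\<lambda>x. std_normal_cdf x + std_normal_cdf (- x)) has_real_derivative 0) (at x)" for x
      by simp
    have "((\<lambda>x. std_normal_cdf (- x)) \<longlongrightarrow> 0) at_top"
      using std_normal.cdf_lim_at_bot by (simp add: filterlim_at_bot_mirror)
    from tendsto_add[OF std_normal.cdf_lim_at_top_prob this]
    show "((\<lambda>x. std_normal_cdf x + std_normal_cdf (- x)) \<longlongrightarrow> 1) at_top"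
      by simp
  qed simp
  then show ?thesis by simp
qed

lemma integrable_std_normal_id: "integrable std_normal_distribution (\<lambda>z. z)"
  using integrable_std_normal_distribution_moment[of 1] by simp

lemma integrable_std_normal_lipschitz:
  fixes h :: "real \<Rightarrow> real"
  assumes "C-lipschitz_on UNIV h"
  shows "integrable std_normal_distribution h"
  using assms integrable_std_normal_id by (rule std_normal.integrable_lipschitz_on_compose)

lemma std_normal_mean_id: "std_normal_mean (\<lambda>z. z) = 0"
  using integral_std_normal_distribution_moment_odd[of 1] by simp

lemma set_integral_std_normal_id:
  "(LINT z:{..x}|std_normal_distribution. z) = - std_normal_density x"
  "(LINT z:{x<..}|std_normal_distribution. z) = std_normal_density x"
proof -
  have "(LINT z:{..x}|std_normal_distribution. z) + std_normal_density x = 0" (is "?F x = 0")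
  proof (rule DERIV_zero_tendsto_imp_eq[where f = ?F])
    show "(?F has_real_derivative 0) (at x)" for x
      by (auto intro!: derivative_eq_intros set_integral_std_normal_has_derivative integrable_std_normal_id)
    show "(?F \<longlongrightarrow> 0) at_bot"
      by (intro tendsto_add_zero set_integral_atMost_tendsto_at_bot
          integrable_std_normal_id std_normal_density_tendsto_at_bot) simp
  qed simp
  then show "(LINT z:{..x}|std_normal_distribution. z) = - std_normal_density x" by simp
  then show "(LINT z:{x<..}|std_normal_distribution. z) = std_normal_density x"
    using set_integral_atMost_add_greaterThan[of std_normal_distribution "\<lambda>z. z" x]
    by (simp add: integrable_std_normal_id std_normal_mean_id)
qed

lemma std_normal_mills_lower: "- x * std_normal_density x \<le> (1 + x\<^sup>2) * std_normal_cdf x"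
proof -
  let ?F = "\<lambda>x. std_normal_cdf x + x / (1 + x\<^sup>2) * std_normal_density x"
  have pos: "1 + x\<^sup>2 > 0" for x :: real by (simp add: add_pos_nonneg)
  have "0 \<le> ?F x"
  proof (rule DERIV_nonneg_tendsto_at_bot_imp_le[where f = ?F])
    fix x :: real
    have "((\<lambda>x. x / (1 + x\<^sup>2)) has_real_derivative (1 - x\<^sup>2) / (1 + x\<^sup>2)\<^sup>2) (at x)"
      using pos[of x] by (auto intro!: derivative_eq_intros simp: power2_eq_square)
    from DERIV_add[OF std_normal_cdf_has_derivative DERIV_mult[OF this std_normal_density_has_derivative]]
    have "(?F has_real_derivative std_normal_density x *
        (1 + (1 - x\<^sup>2) / (1 + x\<^sup>2)\<^sup>2 - x\<^sup>2 / (1 + x\<^sup>2))) (at x)"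
      by (simp add: algebra_simps power2_eq_square)
    also have "1 + (1 - x\<^sup>2) / (1 + x\<^sup>2)\<^sup>2 - x\<^sup>2 / (1 + x\<^sup>2) = 2 / (1 + x\<^sup>2)\<^sup>2"
      using pos[of x] by (simp add: divide_simps) (simp add: algebra_simps power2_eq_square)
    finally show "(?F has_real_derivative std_normal_density x * (2 / (1 + x\<^sup>2)\<^sup>2)) (at x)" .
    show "0 \<le> std_normal_density x * (2 / (1 + x\<^sup>2)\<^sup>2)" by simp
  next
    have "((\<lambda>x::real. x / (1 + x\<^sup>2)) \<longlongrightarrow> 0) at_bot" by real_asymp
    then show "(?F \<longlongrightarrow> 0) at_bot"
      by (intro tendsto_add_zero tendsto_mult_zero std_normal.cdf_lim_at_bot std_normal_density_tendsto_at_bot)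
  qed
  then show ?thesis using pos[of x] by (simp add: field_simps)
qed

lemma std_normal_mills_upper: "x * std_normal_density x \<le> (1 + x\<^sup>2) * (1 - std_normal_cdf x)"
  using std_normal_mills_lower[of "- x"] by (simp add: std_normal_cdf_minus std_normal_density_minus)

section \<open>The mean absolute deviation of a normal variable\<close>

lemma std_normal_lower_partial_moment:
  "(LINT z:{..x}|std_normal_distribution. x - z) = std_normal_density x + x * std_normal_cdf x"
  by (subst set_integral_diff)
     (auto intro!: integrable_imp_set_integrable
           simp: integrable_std_normal_id set_integral_std_normal_const set_integral_std_normal_id)

lemma std_normal_upper_partial_moment:
  "(LINT z:{x<..}|std_normal_distribution. z - x) = std_normal_density x - x * (1 - std_normal_cdf x)"
  by (subst set_integral_diff)
     (auto intro!: integrable_imp_set_integrable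
           simp: integrable_std_normal_id set_integral_std_normal_const set_integral_std_normal_id)

definition std_normal_abs_dev :: "real \<Rightarrow> real" where
  "std_normal_abs_dev x = std_normal_mean (\<lambda>z. \<bar>z - x\<bar>)"

lemma std_normal_abs_dev_eq:
  "std_normal_abs_dev x = 2 * std_normal_density x + x * (2 * std_normal_cdf x - 1)"
proof -
  have "std_normal_abs_dev x = (LINT z:{..x}|std_normal_distribution. \<bar>z - x\<bar>)
      + (LINT z:{x<..}|std_normal_distribution. \<bar>z - x\<bar>)"
    unfolding std_normal_abs_dev_def
    by (subst set_integral_atMost_add_greaterThan)
       (auto intro!: integrable_abs Bochner_Integration.integrable_diff integrable_std_normal_id)
  also have "(LINT z:{..x}|std_normal_distribution. \<bar>z - x\<bar>) = (LINT z:{..x}|std_normal_distribution. x - z)"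
    by (intro set_lebesgue_integral_cong) auto
  also have "(LINT z:{x<..}|std_normal_distribution. \<bar>z - x\<bar>) = (LINT z:{x<..}|std_normal_distribution. z - x)"
    by (intro set_lebesgue_integral_cong) auto
  finally show ?thesis
    by (simp add: std_normal_lower_partial_moment std_normal_upper_partial_moment algebra_simps)
qed

lemma std_normal_abs_dev_minus: "std_normal_abs_dev (- x) = std_normal_abs_dev x"
  by (simp add: std_normal_abs_dev_eq std_normal_density_minus std_normal_cdf_minus algebra_simps)

lemma std_normal_abs_dev_nonneg: "0 \<le> std_normal_abs_dev x"
  unfolding std_normal_abs_dev_def by (rule Bochner_Integration.integral_nonneg) simp

text \<open>
  The partial moments at \<open>x\<close> have sum \<open>std_normal_abs_dev x\<close> and difference \<open>x\<close>, so this bound amounts to the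
  bound \<open>sqrt (2 / pi) * std_normal_density x / 2\<close> for their product.
\<close>

definition abs_dev_bound :: "real \<Rightarrow> real" where
  "abs_dev_bound x = sqrt (x\<^sup>2 + 2 / pi * exp (- x\<^sup>2 / 2))"

lemma abs_dev_bound_square: "(abs_dev_bound x)\<^sup>2 = x\<^sup>2 + 2 / pi * exp (- x\<^sup>2 / 2)"
  unfolding abs_dev_bound_def by (intro real_sqrt_pow2) (simp add: add_nonneg_nonneg)

lemma abs_dev_bound_pos: "0 < abs_dev_bound x"
  unfolding abs_dev_bound_def by (simp add: add_nonneg_pos)

lemma abs_dev_bound_has_derivative [derivative_intros]:
  "(abs_dev_bound has_real_derivative x * (1 - exp (- x\<^sup>2 / 2) / pi) / abs_dev_bound x) (at x)"
proof -
  have "0 < x\<^sup>2 + 2 / pi * exp (- x\<^sup>2 / 2)"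
    using abs_dev_bound_pos[of x] by (simp add: abs_dev_bound_def)
  then show ?thesis
    unfolding abs_dev_bound_def[abs_def] by (auto intro!: derivative_eq_intros simp: field_simps)
qed

text \<open>Division by \<open>x\<close> makes the derivative of the gap free of the distribution function.\<close>

definition abs_dev_gap :: "real \<Rightarrow> real" where
  "abs_dev_gap x = (abs_dev_bound x - 2 * std_normal_density x) / x - (2 * std_normal_cdf x - 1)"

definition abs_dev_gap_slope :: "real \<Rightarrow> real" where
  "abs_dev_gap_slope x = exp (- x\<^sup>2 / 2) / x\<^sup>2 * (2 / sqrt (2 * pi) - (x\<^sup>2 + 2) / (pi * abs_dev_bound x))"

lemma abs_dev_gap_has_derivative:
  assumes "0 < x"
  shows "(abs_dev_gap has_real_derivative abs_dev_gap_slope x) (at x)"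
proof -
  define e s where "e = exp (- x\<^sup>2 / 2)" and "s = abs_dev_bound x"
  have s: "0 < s" "s * s = x\<^sup>2 + 2 / pi * e"
    using abs_dev_bound_pos abs_dev_bound_square[of x] by (simp_all add: s_def e_def power2_eq_square)
  have "(abs_dev_gap has_real_derivative
      ((x * (1 - e / pi) / s + 2 * (x * std_normal_density x)) * x - (s - 2 * std_normal_density x)) / (x * x)
        - 2 * std_normal_density x) (at x)"
    unfolding abs_dev_gap_def[abs_def] e_def s_def using assms by (auto intro!: derivative_eq_intros)
  also have "((x * (1 - e / pi) / s + 2 * (x * std_normal_density x)) * x - (s - 2 * std_normal_density x)) / (x * x)
        - 2 * std_normal_density x
      = (x\<^sup>2 * (1 - e / pi) - s * s) / (s * x\<^sup>2) + 2 * std_normal_density x / x\<^sup>2"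
    using assms s(1) by (simp add: field_simps power2_eq_square)
  also have "\<dots> = abs_dev_gap_slope x"
    unfolding abs_dev_gap_slope_def s(2) std_normal_density_def e_def[symmetric] s_def[symmetric]
    using assms s(1) by (simp add: field_simps)
  finally show ?thesis .
qed

definition abs_dev_discriminant :: "real \<Rightarrow> real" where
  "abs_dev_discriminant t = (t + 2)\<^sup>2 - 2 * pi * t - 4 * exp (- t / 2)"

lemma abs_dev_gap_slope_nonneg_iff:
  assumes "0 < x"
  shows "0 \<le> abs_dev_gap_slope x \<longleftrightarrow> abs_dev_discriminant (x\<^sup>2) \<le> 0"
proof -
  have "0 \<le> abs_dev_gap_slope x \<longleftrightarrow> (x\<^sup>2 + 2) / (pi * abs_dev_bound x) \<le> 2 / sqrt (2 * pi)"
    unfolding abs_dev_gap_slope_def using assms by (simp add: zero_le_mult_iff zero_le_divide_iff)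
  also have "\<dots> \<longleftrightarrow> x\<^sup>2 + 2 \<le> 2 * pi / sqrt (2 * pi) * abs_dev_bound x"
    using abs_dev_bound_pos[of x] by (simp add: field_simps)
  also have "2 * pi / sqrt (2 * pi) = sqrt (2 * pi)"
    by (simp add: real_div_sqrt)
  also have "x\<^sup>2 + 2 \<le> sqrt (2 * pi) * abs_dev_bound x \<longleftrightarrow> (x\<^sup>2 + 2)\<^sup>2 \<le> (sqrt (2 * pi) * abs_dev_bound x)\<^sup>2"
    using abs_dev_bound_pos[of x] by (intro power_mono_iff[symmetric]) (simp_all add: add_nonneg_nonneg)
  also have "(sqrt (2 * pi) * abs_dev_bound x)\<^sup>2 = 2 * pi * x\<^sup>2 + 4 * exp (- x\<^sup>2 / 2)"
    by (simp add: power_mult_distrib abs_dev_bound_square field_simps)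
  finally show ?thesis
    by (simp add: abs_dev_discriminant_def algebra_simps)
qed

text \<open>The discriminant is convex on the positive half-line and vanishes at \<open>0\<close>.\<close>

lemma abs_dev_discriminant_nonpos_downward:
  assumes "abs_dev_discriminant t \<le> 0" "0 \<le> s" "s \<le> t"
  shows "abs_dev_discriminant s \<le> 0"
proof (cases "t = 0")
  case False
  have "convex_on {0..} (\<lambda>t. (t + 2)\<^sup>2 - 2 * pi * t - 4 * exp (- t / 2))"
  proof (rule f''_ge0_imp_convex)
    show "((\<lambda>t. (t + 2)\<^sup>2 - 2 * pi * t - 4 * exp (- t / 2)) has_real_derivative
        2 * (t + 2) - 2 * pi + 2 * exp (- t / 2)) (at t)" for t
      by (auto intro!: derivative_eq_intros)
    show "((\<lambda>t. 2 * (t + 2) - 2 * pi + 2 * exp (- t / 2)) has_real_derivative 2 - exp (- t / 2)) (at t)" for t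
      by (auto intro!: derivative_eq_intros)
    show "0 \<le> 2 - exp (- t / 2)" if "t \<in> {0..}" for t :: real
      using exp_le_one_iff[of "- t / 2"] that by (simp del: exp_le_one_iff)
  qed simp
  then have "convex_on {0..} abs_dev_discriminant"
    by (simp add: abs_dev_discriminant_def[abs_def])
  from convex_onD[OF this, of "s / t" 0 t]
  have "abs_dev_discriminant s \<le> s / t * abs_dev_discriminant t"
    using assms False by (simp add: abs_dev_discriminant_def)
  also have "\<dots> \<le> 0"
    using assms by (intro mult_nonneg_nonpos) auto
  finally show ?thesis .
qed (use assms in simp)

lemma abs_dev_gap_near_0:
  assumes "0 < x"
  shows "1 - 2 * std_normal_cdf x \<le> abs_dev_gap x"
proof -
  have "2 * std_normal_density x \<le> abs_dev_bound x"
    unfolding abs_dev_bound_def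
  proof (rule real_le_rsqrt)
    have "(2 * std_normal_density x)\<^sup>2 = 2 / pi * (exp (- x\<^sup>2 / 2) * exp (- x\<^sup>2 / 2))"
      by (simp add: std_normal_density_def power_mult_distrib power_divide power2_eq_square[of "exp _"])
    also have "\<dots> \<le> 2 / pi * (exp (- x\<^sup>2 / 2) * 1)"
      by (intro mult_left_mono) auto
    also have "\<dots> \<le> x\<^sup>2 + 2 / pi * exp (- x\<^sup>2 / 2)" by simp
    finally show "(2 * std_normal_density x)\<^sup>2 \<le> x\<^sup>2 + 2 / pi * exp (- x\<^sup>2 / 2)" .
  qed
  then show ?thesis using assms by (simp add: abs_dev_gap_def)
qed

lemma abs_dev_gap_near_infinity:
  assumes "0 < x"
  shows "- (1 / x) \<le> abs_dev_gap x"
proof -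
  have "2 \<le> sqrt (2 * pi)" using pi_ge_two by (intro real_le_rsqrt) simp
  then have "2 * std_normal_density x \<le> exp (- x\<^sup>2 / 2)"
    by (simp add: std_normal_density_def field_simps)
  also have "\<dots> \<le> 1" by simp
  finally have "2 * std_normal_density x \<le> 1" .
  moreover have "x \<le> abs_dev_bound x"
    unfolding abs_dev_bound_def by (intro real_le_rsqrt) simp
  ultimately have "(x - 1) / x \<le> (abs_dev_bound x - 2 * std_normal_density x) / x"
    using assms by (intro divide_right_mono) auto
  moreover have "(x - 1) / x = 1 - 1 / x"
    using assms by (simp add: diff_divide_distrib)
  ultimately show ?thesis
    using std_normal.cdf_bounded_prob[of x] by (simp add: abs_dev_gap_def)
qed

lemma abs_dev_gap_nonneg:
  assumes "0 < x"
  shows "0 \<le> abs_dev_gap x"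
proof (rule DERIV_unimodal_imp_nonneg[OF abs_dev_gap_has_derivative _ _ abs_dev_gap_near_0
      _ abs_dev_gap_near_infinity assms])
  show "0 \<le> abs_dev_gap_slope y" if "0 < y" "y \<le> z" "0 \<le> abs_dev_gap_slope z" for y z
    using that abs_dev_discriminant_nonpos_downward[of "z\<^sup>2" "y\<^sup>2"]
    by (simp add: abs_dev_gap_slope_nonneg_iff power_mono)
  have "isCont std_normal_cdf 0"
    using std_normal_cdf_has_derivative by (rule DERIV_isCont)
  then have "(std_normal_cdf \<longlongrightarrow> std_normal_cdf 0) (at_right 0)"
    by (simp add: isCont_def filterlim_at_split)
  then have "((\<lambda>x. 1 - 2 * std_normal_cdf x) \<longlongrightarrow> 1 - 2 * std_normal_cdf 0) (at_right 0)"
    by (intro tendsto_intros)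
  then show "((\<lambda>x. 1 - 2 * std_normal_cdf x) \<longlongrightarrow> 0) (at_right 0)"
    using std_normal_cdf_minus[of 0] by simp
  show "((\<lambda>x::real. - (1 / x)) \<longlongrightarrow> 0) at_top" by real_asymp
qed

lemma std_normal_abs_dev_le: "std_normal_abs_dev x \<le> abs_dev_bound x"
proof -
  have pos: "std_normal_abs_dev x \<le> abs_dev_bound x" if "0 < x" for x
    using abs_dev_gap_nonneg[OF that] that
    by (simp add: abs_dev_gap_def std_normal_abs_dev_eq field_simps)
  consider "0 < x" | "x = 0" | "0 < - x" by linarith
  then show ?thesis
  proof cases
    case 2
    then show ?thesis
      by (simp add: std_normal_abs_dev_eq abs_dev_bound_def std_normal_density_def real_sqrt_divide
          real_sqrt_mult field_simps)
  next
    case 3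
    from pos[OF this] show ?thesis
      by (simp add: std_normal_abs_dev_minus abs_dev_bound_def)
  qed (rule pos)
qed

lemma std_normal_partial_moments_mult_le:
  "(std_normal_density x + x * std_normal_cdf x) * (std_normal_density x - x * (1 - std_normal_cdf x))
    \<le> sqrt (2 / pi) * std_normal_density x / 2" (is "?l * ?u \<le> _")
proof -
  have "4 * (?l * ?u) = (std_normal_abs_dev x)\<^sup>2 - x\<^sup>2"
    by (simp add: std_normal_abs_dev_eq algebra_simps power2_eq_square)
  also have "\<dots> \<le> (abs_dev_bound x)\<^sup>2 - x\<^sup>2"
    using std_normal_abs_dev_le std_normal_abs_dev_nonneg by (intro diff_right_mono power_mono)
  also have "\<dots> = 2 * (sqrt (2 / pi) * std_normal_density x)"
    by (simp add: abs_dev_bound_square std_normal_density_def real_sqrt_divide real_sqrt_mult)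
  finally show ?thesis by linarith
qed

section \<open>Stein's equation for Lipschitz functions\<close>

definition stein_sol :: "(real \<Rightarrow> real) \<Rightarrow> real \<Rightarrow> real" where
  "stein_sol h x = (LINT z:{..x}|std_normal_distribution. h z - std_normal_mean h) / std_normal_density x"

definition stein_sol_deriv :: "(real \<Rightarrow> real) \<Rightarrow> real \<Rightarrow> real" where
  "stein_sol_deriv h x = x * stein_sol h x + (h x - std_normal_mean h)"

lemma stein_sol_has_derivative:
  assumes "integrable std_normal_distribution h" "isCont h x"
  shows "(stein_sol h has_real_derivative stein_sol_deriv h x) (at x)"
proof -
  have "((\<lambda>y. LINT z:{..y}|std_normal_distribution. h z - std_normal_mean h) has_real_derivative
      std_normal_density x * (h x - std_normal_mean h)) (at x)"
    using assms by (intro set_integral_std_normal_has_derivative continuous_intros) auto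
  then show ?thesis
    unfolding stein_sol_def[abs_def] stein_sol_deriv_def using std_normal_density_pos[of x]
    by (auto intro!: derivative_eq_intros simp: field_simps)
qed

lemma stein_sol_linear:
  assumes f: "integrable std_normal_distribution f" and g: "integrable std_normal_distribution g"
  shows "stein_sol (\<lambda>z. a * f z + b * g z) x = a * stein_sol f x + b * stein_sol g x"
proof -
  have "(\<lambda>z. a * f z + b * g z - std_normal_mean (\<lambda>z. a * f z + b * g z))
      = (\<lambda>z. a * (f z - std_normal_mean f) + b * (g z - std_normal_mean g))"
    using f g by (simp add: algebra_simps)
  then show ?thesis
    unfolding stein_sol_def using f g
    by (simp add: integrable_imp_set_integrable add_divide_distrib)
qed

lemma stein_sol_id: "stein_sol (\<lambda>z. z) x = - 1"
  using std_normal_density_pos[of x]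
  by (simp add: stein_sol_def std_normal_mean_id set_integral_std_normal_id)

lemma set_integral_centered_mono_le:
  assumes g: "integrable std_normal_distribution g" and "mono g"
  shows "(LINT z:{..x}|std_normal_distribution. g z - std_normal_mean g)
      \<le> (g x - std_normal_mean g) * std_normal_cdf x"
    and "(LINT z:{..x}|std_normal_distribution. g z - std_normal_mean g)
      \<le> - ((g x - std_normal_mean g) * (1 - std_normal_cdf x))"
proof -
  have int: "set_integrable std_normal_distribution A (\<lambda>z. g z - std_normal_mean g)"
    "set_integrable std_normal_distribution A (\<lambda>z. g x - std_normal_mean g)" if "A \<in> sets borel" for A
    using g that by (auto intro!: integrable_imp_set_integrable)
  show "(LINT z:{..x}|std_normal_distribution. g z - std_normal_mean g)
      \<le> (g x - std_normal_mean g) * std_normal_cdf x"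
    unfolding set_integral_std_normal_const[symmetric]
    by (intro set_integral_mono int) (auto intro: monoD[OF \<open>mono g\<close>])
  have "(g x - std_normal_mean g) * (1 - std_normal_cdf x)
      \<le> (LINT z:{x<..}|std_normal_distribution. g z - std_normal_mean g)"
    unfolding set_integral_std_normal_const[symmetric]
    by (intro set_integral_mono int) (auto intro: monoD[OF \<open>mono g\<close>])
  moreover have "(LINT z:{..x}|std_normal_distribution. g z - std_normal_mean g)
      + (LINT z:{x<..}|std_normal_distribution. g z - std_normal_mean g) = 0"
    using g by (subst set_integral_atMost_add_greaterThan) simp_all
  ultimately show "(LINT z:{..x}|std_normal_distribution. g z - std_normal_mean g)
      \<le> - ((g x - std_normal_mean g) * (1 - std_normal_cdf x))" by simp
qed

lemma stein_sol_mono_nonpos: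
  assumes "integrable std_normal_distribution g" "mono g"
  shows "stein_sol g x \<le> 0"
    and "(1 + x\<^sup>2) * stein_sol g x + x * (g x - std_normal_mean g) \<le> 0"
proof -
  define c L \<Phi> \<phi> where "c = g x - std_normal_mean g"
    and "L = (LINT z:{..x}|std_normal_distribution. g z - std_normal_mean g)"
    and "\<Phi> = std_normal_cdf x" and "\<phi> = std_normal_density x"
  have \<Phi>: "0 \<le> \<Phi>" "\<Phi> \<le> 1"
    by (simp_all add: \<Phi>_def std_normal.cdf_nonneg std_normal.cdf_bounded_prob)
  have L: "L \<le> c * \<Phi>" "L \<le> - (c * (1 - \<Phi>))"
    using set_integral_centered_mono_le[OF assms, of x] by (simp_all add: L_def c_def \<Phi>_def)
  have x: "0 \<le> 1 + x\<^sup>2" by (simp add: add_nonneg_nonneg)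
  have "L \<le> 0 \<and> (1 + x\<^sup>2) * L + x * c * \<phi> \<le> 0"
  proof (cases "0 \<le> c")
    case True
    have "(1 + x\<^sup>2) * L \<le> - (c * ((1 + x\<^sup>2) * (1 - \<Phi>)))"
      using mult_left_mono[OF L(2) x] by (simp add: mult_ac)
    also have "\<dots> \<le> - (c * (x * \<phi>))"
      using mult_left_mono[OF std_normal_mills_upper True] by (simp add: \<Phi>_def \<phi>_def)
    finally show ?thesis
      using L(2) mult_nonneg_nonneg[OF True, of "1 - \<Phi>"] \<Phi> by (simp add: mult_ac)
  next
    case False
    have "(1 + x\<^sup>2) * L \<le> c * ((1 + x\<^sup>2) * \<Phi>)"
      using mult_left_mono[OF L(1) x] by (simp add: mult_ac)
    also have "\<dots> \<le> c * (- x * \<phi>)"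
      unfolding \<Phi>_def \<phi>_def using False by (intro mult_left_mono_neg std_normal_mills_lower) simp
    finally show ?thesis
      using L(1) mult_nonpos_nonneg[of c \<Phi>] False \<Phi> by (simp add: mult_ac)
  qed
  moreover have "stein_sol g x = L / \<phi>" "0 < \<phi>"
    by (simp_all add: stein_sol_def L_def \<phi>_def std_normal_density_pos)
  ultimately show "stein_sol g x \<le> 0" "(1 + x\<^sup>2) * stein_sol g x + x * (g x - std_normal_mean g) \<le> 0"
    unfolding c_def[symmetric] by (auto simp: divide_le_0_iff) (simp add: field_simps)
qed

lemma std_normal_density_mult_stein_sol_deriv:
  assumes h: "integrable std_normal_distribution h"
  shows "std_normal_density x * stein_sol_deriv h x
    = - ((LINT z:{..x}|std_normal_distribution. h z - h x) * (std_normal_density x - x * (1 - std_normal_cdf x))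
        + (LINT z:{x<..}|std_normal_distribution. h z - h x) * (std_normal_density x + x * std_normal_cdf x))"
proof -
  define l u m \<Phi> \<phi> where "l = (LINT z:{..x}|std_normal_distribution. h z - h x)"
    and "u = (LINT z:{x<..}|std_normal_distribution. h z - h x)"
    and "m = std_normal_mean h" and "\<Phi> = std_normal_cdf x" and "\<phi> = std_normal_density x"
  have m: "m = h x + l + u"
    using h set_integral_atMost_add_greaterThan[of std_normal_distribution "\<lambda>z. h z - h x" x]
    by (simp add: l_def u_def m_def)
  have centered: "(LINT z:{..x}|std_normal_distribution. h z - c)
      = (LINT z:{..x}|std_normal_distribution. h z) - c * \<Phi>" for c
    unfolding \<Phi>_def using h
    by (subst set_integral_diff)
       (auto intro!: integrable_imp_set_integrable simp: set_integral_std_normal_const)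
  have sol: "\<phi> * stein_sol h x = l - (l + u) * \<Phi>"
    using std_normal_density_pos[of x] centered[of m] centered[of "h x"]
    by (simp add: stein_sol_def m_def[symmetric] l_def[symmetric] \<phi>_def m algebra_simps)
  have "\<phi> * stein_sol_deriv h x = x * (\<phi> * stein_sol h x) - (l + u) * \<phi>"
    unfolding stein_sol_deriv_def m_def[symmetric] by (simp add: m algebra_simps)
  also have "\<dots> = - (l * (\<phi> - x * (1 - \<Phi>)) + u * (\<phi> + x * \<Phi>))"
    unfolding sol by (simp add: algebra_simps)
  finally show ?thesis unfolding l_def u_def \<Phi>_def \<phi>_def .
qed

lemma stein_sol_deriv_bound:
  assumes lip: "C-lipschitz_on UNIV h"
  shows "\<bar>stein_sol_deriv h x\<bar> \<le> C * sqrt (2 / pi)"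
proof -
  define l u a b \<phi> where "l = (LINT z:{..x}|std_normal_distribution. h z - h x)"
    and "u = (LINT z:{x<..}|std_normal_distribution. h z - h x)"
    and "a = std_normal_density x + x * std_normal_cdf x"
    and "b = std_normal_density x - x * (1 - std_normal_cdf x)" and "\<phi> = std_normal_density x"
  have h: "integrable std_normal_distribution h"
    using lip by (rule integrable_std_normal_lipschitz)
  have bound: "\<bar>LINT z:A|std_normal_distribution. h z - h x\<bar>
      \<le> C * (LINT z:A|std_normal_distribution. \<bar>z - x\<bar>)"
    if "A \<in> sets borel" for A
    unfolding set_integral_mult_right[symmetric]
    using h that lipschitz_onD[OF lip] integrable_std_normal_id
    by (intro set_integral_abs_le) (auto simp: dist_real_def)
  have l: "\<bar>l\<bar> \<le> C * a"
    using bound[of "{..x}"]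
      set_lebesgue_integral_cong[of "{..x}" std_normal_distribution "\<lambda>z. \<bar>z - x\<bar>" "\<lambda>z. x - z"]
    by (simp add: l_def a_def std_normal_lower_partial_moment)
  have u: "\<bar>u\<bar> \<le> C * b"
    using bound[of "{x<..}"]
      set_lebesgue_integral_cong[of "{x<..}" std_normal_distribution "\<lambda>z. \<bar>z - x\<bar>" "\<lambda>z. z - x"]
    by (simp add: u_def b_def std_normal_upper_partial_moment)
  have ab: "0 \<le> a" "0 \<le> b"
    unfolding a_def b_def std_normal_lower_partial_moment[symmetric] std_normal_upper_partial_moment[symmetric]
      set_lebesgue_integral_def
    by (auto intro!: Bochner_Integration.integral_nonneg simp: indicator_def)
  have "\<phi> * \<bar>stein_sol_deriv h x\<bar> = \<bar>\<phi> * stein_sol_deriv h x\<bar>"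
    by (simp add: abs_mult \<phi>_def)
  also have "\<dots> = \<bar>l * b + u * a\<bar>"
    unfolding \<phi>_def std_normal_density_mult_stein_sol_deriv[OF h] l_def u_def a_def b_def
    by (rule abs_minus_cancel)
  also have "\<dots> \<le> \<bar>l\<bar> * b + \<bar>u\<bar> * a"
    using abs_triangle_ineq[of "l * b" "u * a"] ab by (simp add: abs_mult)
  also have "\<dots> \<le> C * a * b + C * b * a"
    using l u ab by (intro add_mono mult_right_mono)
  also have "\<dots> = 2 * C * (a * b)" by simp
  also have "\<dots> \<le> 2 * C * (sqrt (2 / pi) * \<phi> / 2)"
    unfolding a_def b_def \<phi>_def using lipschitz_on_nonneg[OF lip]
    by (intro mult_left_mono std_normal_partial_moments_mult_le) simp
  finally show ?thesis
    using std_normal_density_pos[of x] by (simp add: \<phi>_def mult_ac)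
qed

text \<open>
  \<open>h\<close> is \<open>C\<close>-Lipschitz iff \<open>C * z + h z\<close> and \<open>C * z - h z\<close> are both increasing, and the solution for the
  identity is \<open>-1\<close>; so the signs for monotone functions become bounds on \<open>f = stein_sol h\<close> and \<open>(x * f x)'\<close>,
  the latter without differentiating \<open>h\<close>.
\<close>

lemma stein_sol_lipschitz_bounds:
  assumes lip: "C-lipschitz_on UNIV h"
  shows "\<bar>stein_sol h x\<bar> \<le> C"
    and "\<bar>(1 + x\<^sup>2) * stein_sol h x + x * (h x - std_normal_mean h)\<bar> \<le> C"
proof -
  have h: "integrable std_normal_distribution h"
    using lip by (rule integrable_std_normal_lipschitz)
  have signed: "c * stein_sol h x \<le> C \<and> c * ((1 + x\<^sup>2) * stein_sol h x + x * (h x - std_normal_mean h)) \<le> C"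
    if "\<bar>c\<bar> = 1" for c
  proof -
    let ?g = "\<lambda>z. C * z + c * h z"
    have g: "integrable std_normal_distribution ?g"
      using h integrable_std_normal_id by simp
    have mono: "mono ?g"
    proof (rule monoI)
      fix y z :: real assume "y \<le> z"
      moreover have "\<bar>c * (h y - h z)\<bar> \<le> C * \<bar>y - z\<bar>"
        using lipschitz_onD[OF lip, of y z] that by (simp add: abs_mult dist_real_def)
      ultimately show "?g y \<le> ?g z" by (simp add: abs_le_iff algebra_simps)
    qed
    have sol: "stein_sol ?g x = c * stein_sol h x - C"
      using stein_sol_linear[OF integrable_std_normal_id h] by (simp add: stein_sol_id)
    have mean: "std_normal_mean ?g = c * std_normal_mean h"
      using h by (simp add: integrable_std_normal_id std_normal_mean_id)
    show ?thesis
      using stein_sol_mono_nonpos[OF g mono, of x] unfolding sol mean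
      by (simp add: algebra_simps power2_eq_square)
  qed
  from signed[of 1] signed[of "- 1"]
  show "\<bar>stein_sol h x\<bar> \<le> C" "\<bar>(1 + x\<^sup>2) * stein_sol h x + x * (h x - std_normal_mean h)\<bar> \<le> C"
    by (simp_all add: abs_le_iff)
qed

lemma stein_sol_deriv_lipschitz:
  assumes lip: "C-lipschitz_on UNIV h"
  shows "(2 * C)-lipschitz_on UNIV (stein_sol_deriv h)"
proof -
  have h: "integrable std_normal_distribution h"
    using lip by (rule integrable_std_normal_lipschitz)
  have cont: "isCont h x" for x
    using lipschitz_on_continuous_within[OF lip, of x] by simp
  have "C-lipschitz_on UNIV (\<lambda>x. x * stein_sol h x)"
  proof (rule lipschitz_onI)
    have "((\<lambda>x. x * stein_sol h x) has_real_derivative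
        (1 + x\<^sup>2) * stein_sol h x + x * (h x - std_normal_mean h)) (at x within UNIV)" for x
      by (auto intro!: derivative_eq_intros stein_sol_has_derivative h cont
          simp: stein_sol_deriv_def algebra_simps power2_eq_square)
    from field_differentiable_bound[OF convex_UNIV this] stein_sol_lipschitz_bounds(2)[OF lip]
    show "dist (x * stein_sol h x) (y * stein_sol h y) \<le> C * dist x y" for x y
      by (simp add: dist_real_def)
  qed (rule lipschitz_on_nonneg[OF lip])
  from lipschitz_on_add[OF this lipschitz_on_diff[OF lip lipschitz_on_constant[of _ "std_normal_mean h"]]]
  show ?thesis
    unfolding stein_sol_deriv_def[abs_def] by simp
qed

section \<open>Conditional moments of a coupling\<close>

lemma subalgebra_sigma_WY:
  assumes [measurable]: "W \<in> borel_measurable M" "Y \<in> borel_measurable M"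
  shows "subalgebra M (sigma_WY M W Y)"
  unfolding subalgebra_def sigma_WY_def
  by (intro conjI sets_image_in_sets space_vimage_algebra refl) measurable

lemma measurable_sigma_WY:
  assumes "u \<in> borel_measurable (borel \<Otimes>\<^sub>M borel)"
  shows "(\<lambda>\<omega>. u (W \<omega>, Y \<omega>)) \<in> borel_measurable (sigma_WY M W Y)"
proof -
  have "(\<lambda>\<omega>. (W \<omega>, Y \<omega>)) \<in> measurable (sigma_WY M W Y) borel"
    unfolding sigma_WY_def by (rule measurable_vimage_algebra1) simp
  from measurable_compose[OF this] assms show ?thesis by (simp add: borel_prod)
qed

locale coupled_vectors = prob_space M for M :: "'a measure" +
  fixes W Y W' Y' :: "'a \<Rightarrow> real"
  assumes meas [measurable]: "W \<in> borel_measurable M" "Y \<in> borel_measurable M"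
      "W' \<in> borel_measurable M" "Y' \<in> borel_measurable M"
begin

definition level :: "real \<Rightarrow> 'a set" where
  "level j = {\<omega> \<in> space M. Y \<omega> = j}"

definition jump :: "real \<Rightarrow> 'a set" where
  "jump s = {\<omega> \<in> space M. Y' \<omega> - Y \<omega> = s}"

definition flow :: "(real \<Rightarrow> real) \<Rightarrow> real \<Rightarrow> real \<Rightarrow> real" where
  "flow G j s = (LINT \<omega>:level j \<inter> jump s|M. G (W' \<omega>) - G (W \<omega>))"

definition stein_operator :: "(real \<Rightarrow> real) \<Rightarrow> (real \<Rightarrow> real) \<Rightarrow> 'a \<Rightarrow> real" where
  "stein_operator f f' \<omega> = f' (W \<omega>) - W \<omega> * f (W \<omega>)"

definition third_abs_moment :: real where
  "third_abs_moment = (\<integral>\<omega>. \<bar>W' \<omega> - W \<omega>\<bar> ^ 3 \<partial>M)"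

lemma sets_level [measurable]: "level j \<in> sets M"
  unfolding level_def by measurable

lemma sets_jump [measurable]: "jump s \<in> sets M"
  unfolding jump_def by measurable

sublocale sigma_WY: finite_measure_subalgebra M "sigma_WY M W Y"
  by unfold_locales (intro subalgebra_sigma_WY meas)

lemma integrable_jump_moment:
  assumes "integrable M (\<lambda>\<omega>. (W' \<omega> - W \<omega>) ^ l)"
  shows "integrable M (\<lambda>\<omega>. (W' \<omega> - W \<omega>) ^ l * (if Y' \<omega> - Y \<omega> = s then 1 else 0))"
  using assms by (rule Bochner_Integration.integrable_bound) auto

lemma integrable_Mcond:
  assumes "integrable M (\<lambda>\<omega>. (W' \<omega> - W \<omega>) ^ l)"
  shows "integrable M (Mcond M W Y W' Y' l s)"
  unfolding Mcond_def using integrable_jump_moment[OF assms] by (rule sigma_WY.real_cond_exp_int)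

lemma set_integral_Mcond:
  fixes v :: "real \<Rightarrow> real"
  assumes int: "integrable M (\<lambda>\<omega>. (W' \<omega> - W \<omega>) ^ l)"
    and [measurable]: "v \<in> borel_measurable borel" and bound: "\<And>x. \<bar>v x\<bar> \<le> B"
  shows "(LINT \<omega>:level j|M. v (W \<omega>) * Mcond M W Y W' Y' l s \<omega>)
    = (LINT \<omega>:level j \<inter> jump s|M. v (W \<omega>) * (W' \<omega> - W \<omega>) ^ l)"
proof -
  define u where "u \<omega> = (if Y \<omega> = j then v (W \<omega>) else 0)" for \<omega>
  let ?g = "\<lambda>\<omega>. (W' \<omega> - W \<omega>) ^ l * (if Y' \<omega> - Y \<omega> = s then 1 else 0)"
  have u: "u \<in> borel_measurable (sigma_WY M W Y)"
    using measurable_sigma_WY[of "\<lambda>(w, y). if y = j then v w else 0" W Y M] by (simp add: u_def[abs_def])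
  have "\<bar>u \<omega>\<bar> \<le> \<bar>B\<bar>" for \<omega>
    using bound[of "W \<omega>"] by (auto simp: u_def)
  then have u_int: "integrable M (\<lambda>\<omega>. u \<omega> * ?g \<omega>)"
    using measurable_from_subalg[OF sigma_WY.subalg u]
    by (intro integrable_bounded_mult[OF integrable_jump_moment[OF int]])
  have "(LINT \<omega>:level j|M. v (W \<omega>) * Mcond M W Y W' Y' l s \<omega>)
      = (\<integral>\<omega>. u \<omega> * Mcond M W Y W' Y' l s \<omega> \<partial>M)"
    unfolding set_lebesgue_integral_def
    by (intro Bochner_Integration.integral_cong) (auto simp: u_def level_def)
  also have "\<dots> = (\<integral>\<omega>. u \<omega> * ?g \<omega> \<partial>M)"
    unfolding Mcond_def by (rule sigma_WY.real_cond_exp_intg(2)[OF u_int u]) measurable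
  also have "\<dots> = (LINT \<omega>:level j \<inter> jump s|M. v (W \<omega>) * (W' \<omega> - W \<omega>) ^ l)"
    unfolding set_lebesgue_integral_def
    by (intro Bochner_Integration.integral_cong) (auto simp: u_def level_def jump_def indicator_def)
  finally show ?thesis .
qed

lemma flow_tendsto_0:
  assumes "integrable M (\<lambda>\<omega>. G (W' \<omega>) - G (W \<omega>))"
  shows "(\<lambda>n. flow G (k - real n) s) \<longlonglongrightarrow> 0"
  unfolding flow_def
proof (rule set_integral_escaping_tendsto_0[OF assms])
  fix \<omega>
  have "\<forall>\<^sub>F n in sequentially. k - Y \<omega> < real n"
    using filterlim_real_sequentially by (simp add: filterlim_at_top_dense)
  then show "\<forall>\<^sub>F n in sequentially. \<omega> \<notin> level (k - real n) \<inter> jump s"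
    by eventually_elim (auto simp: level_def)
qed measurable

text \<open>The levels below \<open>k\<close> are disjoint, so the errors of a downward iteration add up to one integral.\<close>

lemma abs_le_set_integral_below:
  fixes a :: "real \<Rightarrow> real"
  assumes int: "integrable M e" and nonneg: "\<And>\<omega>. 0 \<le> e \<omega>"
    and step: "\<And>j. \<bar>a j\<bar> \<le> \<bar>a (j - 1)\<bar> + (LINT \<omega>:level (j - 1)|M. e \<omega>)"
    and lim: "(\<lambda>n. a (k - real n)) \<longlonglongrightarrow> 0"
  shows "\<bar>a k\<bar> \<le> (LINT \<omega>:{\<omega> \<in> space M. Y \<omega> < k}|M. e \<omega>)"
proof -
  let ?below = "{\<omega> \<in> space M. Y \<omega> < k}"
  define window where "window n = {\<omega> \<in> space M. k - real n \<le> Y \<omega> \<and> Y \<omega> < k}" for n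
  have [measurable]: "window n \<in> sets M" for n
    unfolding window_def by measurable
  have iterate: "\<bar>a k\<bar> \<le> \<bar>a (k - real n)\<bar> + (LINT \<omega>:window n|M. e \<omega>)" for n
  proof (induction n)
    case 0
    then show ?case by (simp add: window_def set_lebesgue_integral_def)
  next
    case (Suc n)
    have "(LINT \<omega>:level (k - real (Suc n))|M. e \<omega>) + (LINT \<omega>:window n|M. e \<omega>)
        = (LINT \<omega>:level (k - real (Suc n)) \<union> window n|M. e \<omega>)"
      using int by (intro set_integral_Un[symmetric] integrable_imp_set_integrable)
        (auto simp: level_def window_def)
    also have "\<dots> \<le> (LINT \<omega>:window (Suc n)|M. e \<omega>)"
      using int nonneg by (intro set_integral_mono_set) (auto simp: level_def window_def)
    finally show ?case
      using Suc step[of "k - real n"] by (simp add: algebra_simps)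
  qed
  have "\<bar>a k\<bar> \<le> \<bar>a (k - real n)\<bar> + (LINT \<omega>:?below|M. e \<omega>)" for n
  proof -
    have "(LINT \<omega>:window n|M. e \<omega>) \<le> (LINT \<omega>:?below|M. e \<omega>)"
      using int nonneg by (intro set_integral_mono_set) (auto simp: window_def)
    with iterate[of n] show ?thesis by linarith
  qed
  moreover have "(\<lambda>n. \<bar>a (k - real n)\<bar> + (LINT \<omega>:?below|M. e \<omega>)) \<longlonglongrightarrow> 0 + (LINT \<omega>:?below|M. e \<omega>)"
    using lim by (intro tendsto_add tendsto_rabs_zero tendsto_const)
  ultimately show ?thesis
    using tendsto_lowerbound[of _ "0 + (LINT \<omega>:?below|M. e \<omega>)" sequentially "\<bar>a k\<bar>"] by simp
qed

lemma set_integral_stein_operator_stein_sol: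
  assumes "integrable M (\<lambda>\<omega>. h (W \<omega>))"
  shows "(LINT \<omega>:level k|M. stein_operator (stein_sol h) (stein_sol_deriv h) \<omega>)
    = (LINT \<omega>:level k|M. h (W \<omega>)) - std_normal_mean h * measure M (level k)"
  unfolding stein_operator_def stein_sol_deriv_def using assms
  by (simp add: integrable_imp_set_integrable set_integral_const)

lemma cond_exp_event_level: "cond_exp_event M X (level k) = (LINT \<omega>:level k|M. X \<omega>) / measure M (level k)"
  by (simp add: cond_exp_event_def set_lebesgue_integral_def mult.commute)

end

section \<open>Exchangeable pairs\<close>

locale exchangeable_pair = coupled_vectors +
  assumes exch: "distr M borel (\<lambda>\<omega>. (W \<omega>, Y \<omega>, W' \<omega>, Y' \<omega>)) = distr M borel (\<lambda>\<omega>. (W' \<omega>, Y' \<omega>, W \<omega>, Y \<omega>))"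
begin

lemma
  fixes F :: "real \<times> real \<times> real \<times> real \<Rightarrow> real"
  assumes F: "F \<in> borel_measurable borel"
  shows integral_exchange: "(\<integral>\<omega>. F (W \<omega>, Y \<omega>, W' \<omega>, Y' \<omega>) \<partial>M) = (\<integral>\<omega>. F (W' \<omega>, Y' \<omega>, W \<omega>, Y \<omega>) \<partial>M)"
    and integrable_exchange:
      "integrable M (\<lambda>\<omega>. F (W \<omega>, Y \<omega>, W' \<omega>, Y' \<omega>)) \<longleftrightarrow> integrable M (\<lambda>\<omega>. F (W' \<omega>, Y' \<omega>, W \<omega>, Y \<omega>))"
proof -
  have vec: "(\<lambda>\<omega>. (W \<omega>, Y \<omega>, W' \<omega>, Y' \<omega>)) \<in> measurable M borel"
    "(\<lambda>\<omega>. (W' \<omega>, Y' \<omega>, W \<omega>, Y \<omega>)) \<in> measurable M borel"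
    by measurable
  show "(\<integral>\<omega>. F (W \<omega>, Y \<omega>, W' \<omega>, Y' \<omega>) \<partial>M) = (\<integral>\<omega>. F (W' \<omega>, Y' \<omega>, W \<omega>, Y \<omega>) \<partial>M)"
    using integral_distr[OF vec(1) F] integral_distr[OF vec(2) F] by (simp add: exch)
  show "integrable M (\<lambda>\<omega>. F (W \<omega>, Y \<omega>, W' \<omega>, Y' \<omega>)) \<longleftrightarrow> integrable M (\<lambda>\<omega>. F (W' \<omega>, Y' \<omega>, W \<omega>, Y \<omega>))"
    using integrable_distr_eq[OF vec(1) F] integrable_distr_eq[OF vec(2) F] by (simp add: exch)
qed

lemma flow_reverse:
  assumes [measurable]: "G \<in> borel_measurable borel"
  shows "flow G j (- s) = - flow G (j - s) s"
proof -
  define F :: "real \<times> real \<times> real \<times> real \<Rightarrow> real" where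
    "F = (\<lambda>(w, y, w', y'). if y = j \<and> y' - y = - s then G w' - G w else 0)"
  have "F \<in> borel_measurable borel"
    unfolding F_def borel_prod[symmetric] by measurable
  have "flow G j (- s) = (\<integral>\<omega>. F (W \<omega>, Y \<omega>, W' \<omega>, Y' \<omega>) \<partial>M)"
    unfolding flow_def set_lebesgue_integral_def
    by (intro Bochner_Integration.integral_cong) (auto simp: F_def level_def jump_def indicator_def)
  also have "\<dots> = (\<integral>\<omega>. F (W' \<omega>, Y' \<omega>, W \<omega>, Y \<omega>) \<partial>M)"
    by (rule integral_exchange) fact
  also have "\<dots> = (\<integral>\<omega>. - (indicat_real (level (j - s) \<inter> jump s) \<omega> *\<^sub>R (G (W' \<omega>) - G (W \<omega>))) \<partial>M)"
    by (intro Bochner_Integration.integral_cong) (auto simp: F_def level_def jump_def indicator_def)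
  finally show ?thesis
    by (simp add: flow_def set_lebesgue_integral_def)
qed

end

section \<open>Stein's method for a conditional law\<close>

lemma dW_cond_normal_leI:
  assumes le: "\<And>h. 1-lipschitz_on UNIV h \<Longrightarrow> \<bar>cond_exp_event M (\<lambda>\<omega>. h (V \<omega>)) B - std_normal_mean h\<bar> \<le> b"
  shows "dW_cond_normal M V B \<le> ennreal b"
  unfolding dW_cond_normal_def
proof (rule SUP_least)
  fix h assume "h \<in> {h. lipschitz1 h}"
  then have lip: "1-lipschitz_on UNIV h"
    by (auto simp: lipschitz1_def lipschitz_on_def dist_real_def)
  have "h \<in> borel_measurable borel"
    using lipschitz_on_continuous_on[OF lip] by (rule borel_measurable_continuous_onI)
  then have "(\<integral>z. std_normal_density z * h z \<partial>lborel) = std_normal_mean h"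
    by (simp add: integral_density normal_density_nonneg)
  with le[OF lip]
  show "ennreal \<bar>cond_exp_event M (\<lambda>\<omega>. h (V \<omega>)) B - (\<integral>z. std_normal_density z * h z \<partial>lborel)\<bar> \<le> ennreal b"
    by (intro ennreal_leI) simp
qed

text \<open>The first argument of \<open>R1\<close> and \<open>R2\<close> is the sign of the jump of \<open>Y\<close>.\<close>

locale stein_pair = exchangeable_pair +
  fixes R1 R2 :: "real \<Rightarrow> 'a \<Rightarrow> real" and lam psi :: real
  assumes W_square_integrable: "integrable M (\<lambda>\<omega>. (W \<omega>)\<^sup>2)"
    and lam_pos: "0 < lam" and psi_pos: "0 < psi"
    and R_meas [measurable]: "\<And>s. R1 s \<in> borel_measurable M" "\<And>s. R2 s \<in> borel_measurable M"
    and Mcond_1: "\<And>s. s \<in> {1, -1} \<Longrightarrow> AE \<omega> in M. Mcond M W Y W' Y' 1 s \<omega> = - lam * (psi * W \<omega> / 2 + R1 s \<omega>)"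
    and Mcond_2: "\<And>s. s \<in> {1, -1} \<Longrightarrow> AE \<omega> in M. Mcond M W Y W' Y' 2 s \<omega> = lam * (psi + R2 s \<omega>)"
begin

definition sign_gap :: "(real \<Rightarrow> 'a \<Rightarrow> real) \<Rightarrow> real" where
  "sign_gap R = (\<integral>\<omega>. \<bar>R 1 \<omega> - R (-1) \<omega>\<bar> \<partial>M)"

lemma W_integrable: "integrable M W"
  by (rule square_integrable_imp_integrable[OF meas(1) W_square_integrable])

lemma W_diff_integrable: "integrable M (\<lambda>\<omega>. W' \<omega> - W \<omega>)"
proof -
  have "(fst :: real \<times> real \<times> real \<times> real \<Rightarrow> real) \<in> borel_measurable borel"
    unfolding borel_prod[symmetric] by measurable
  from integrable_exchange[OF this] have "integrable M W'"
    using W_integrable by simp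
  then show ?thesis using W_integrable by simp
qed

lemma W_diff_square_integrable: "integrable M (\<lambda>\<omega>. (W' \<omega> - W \<omega>)\<^sup>2)"
proof (rule Bochner_Integration.integrable_bound)
  have "(\<lambda>x :: real \<times> real \<times> real \<times> real. (fst x)\<^sup>2) \<in> borel_measurable borel"
    unfolding borel_prod[symmetric] by measurable
  from integrable_exchange[OF this] have "integrable M (\<lambda>\<omega>. (W' \<omega>)\<^sup>2)"
    using W_square_integrable by simp
  then show "integrable M (\<lambda>\<omega>. 2 * (W' \<omega>)\<^sup>2 + 2 * (W \<omega>)\<^sup>2)"
    using W_square_integrable by simp
  have "(w' - w)\<^sup>2 \<le> 2 * w'\<^sup>2 + 2 * w\<^sup>2" for w w' :: real
    using zero_le_power2[of "w' + w"] by (simp add: power2_eq_square algebra_simps)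
  then show "AE \<omega> in M. norm ((W' \<omega> - W \<omega>)\<^sup>2) \<le> norm (2 * (W' \<omega>)\<^sup>2 + 2 * (W \<omega>)\<^sup>2)"
    by simp
qed measurable

lemma R_integrable:
  assumes s: "s \<in> {1, -1}"
  shows "integrable M (R1 s)" "integrable M (R2 s)"
proof -
  have "integrable M (\<lambda>\<omega>. - (Mcond M W Y W' Y' 1 s \<omega> / lam) - psi * W \<omega> / 2)"
    using integrable_Mcond[of 1 s] W_diff_integrable W_integrable by simp
  moreover have "AE \<omega> in M. - (Mcond M W Y W' Y' 1 s \<omega> / lam) - psi * W \<omega> / 2 = R1 s \<omega>"
    using Mcond_1[OF s] lam_pos by (auto elim!: eventually_mono)
  ultimately show "integrable M (R1 s)"
    by (rule integrable_cong_AE_imp[OF _ R_meas(1)])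
  have "integrable M (\<lambda>\<omega>. Mcond M W Y W' Y' 2 s \<omega> / lam - psi)"
    using integrable_Mcond[of 2 s] W_diff_square_integrable by simp
  moreover have "AE \<omega> in M. Mcond M W Y W' Y' 2 s \<omega> / lam - psi = R2 s \<omega>"
    using Mcond_2[OF s] lam_pos by (auto elim!: eventually_mono)
  ultimately show "integrable M (R2 s)"
    by (rule integrable_cong_AE_imp[OF _ R_meas(2)])
qed

lemma R_diff_integrable:
  "integrable M (\<lambda>\<omega>. R1 1 \<omega> - R1 (-1) \<omega>)" "integrable M (\<lambda>\<omega>. R2 1 \<omega> - R2 (-1) \<omega>)"
  using R_integrable by auto

context
  fixes f f' G :: "real \<Rightarrow> real" and c0 c1 c2 :: real
  assumes G: "\<And>x. (G has_real_derivative f x) (at x)" and f: "\<And>x. (f has_real_derivative f' x) (at x)"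
    and f_bound: "\<And>x. \<bar>f x\<bar> \<le> c0" and f'_bound: "\<And>x. \<bar>f' x\<bar> \<le> c1"
    and f'_lipschitz: "c2-lipschitz_on UNIV f'"
    and third_moment: "integrable M (\<lambda>\<omega>. \<bar>W' \<omega> - W \<omega>\<bar> ^ 3)"
begin

definition drift :: "real \<Rightarrow> 'a \<Rightarrow> real" where
  "drift s \<omega> = f (W \<omega>) * (- lam * (psi * W \<omega> / 2 + R1 s \<omega>)) + f' (W \<omega>) * (lam * (psi + R2 s \<omega>)) / 2"

definition remainder :: "'a \<Rightarrow> real" where
  "remainder \<omega> = G (W' \<omega>) - G (W \<omega>) - f (W \<omega>) * (W' \<omega> - W \<omega>) - f' (W \<omega>) * (W' \<omega> - W \<omega>)\<^sup>2 / 2"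

definition cubic_error :: "'a \<Rightarrow> real" where
  "cubic_error \<omega> = c2 / 6 * \<bar>W' \<omega> - W \<omega>\<bar> ^ 3"

definition R_error :: "real \<Rightarrow> 'a \<Rightarrow> real" where
  "R_error s \<omega> = f (W \<omega>) * R1 s \<omega> - f' (W \<omega>) * R2 s \<omega> / 2"

definition asymmetry :: "'a \<Rightarrow> real" where
  "asymmetry \<omega> = lam * (c0 * \<bar>R1 1 \<omega> - R1 (-1) \<omega>\<bar> + c1 / 2 * \<bar>R2 1 \<omega> - R2 (-1) \<omega>\<bar>)"

definition flow_error :: "'a \<Rightarrow> real" where
  "flow_error \<omega> = asymmetry \<omega> + cubic_error \<omega>"

lemma bounds_nonneg: "0 \<le> c0" "0 \<le> c1" "0 \<le> c2"
  using f_bound[of 0] f'_bound[of 0] lipschitz_on_nonneg[OF f'_lipschitz] by linarith+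

lemma test_function_meas [measurable]:
  "f \<in> borel_measurable borel" "f' \<in> borel_measurable borel" "G \<in> borel_measurable borel"
  using DERIV_continuous_on[of UNIV f f'] DERIV_continuous_on[of UNIV G f] f G
    lipschitz_on_continuous_on[OF f'_lipschitz]
  by (simp_all add: borel_measurable_continuous_onI)

lemma f_mult_integrable: "integrable M g \<Longrightarrow> integrable M (\<lambda>\<omega>. f (W \<omega>) * g \<omega>)"
  by (rule integrable_bounded_mult[OF _ _ f_bound]) auto

lemma f'_mult_integrable: "integrable M g \<Longrightarrow> integrable M (\<lambda>\<omega>. f' (W \<omega>) * g \<omega>)"
  by (rule integrable_bounded_mult[OF _ _ f'_bound]) auto

lemma drift_integrable:
  assumes "s \<in> {1, -1}"
  shows "integrable M (drift s)"
  unfolding drift_def[abs_def] using W_integrable R_integrable[OF assms]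
  by (intro Bochner_Integration.integrable_add integrable_divide f_mult_integrable f'_mult_integrable) auto

lemma cubic_error_integrable: "integrable M cubic_error"
  unfolding cubic_error_def[abs_def] using third_moment by simp

lemma cubic_error_nonneg: "0 \<le> cubic_error \<omega>"
  using bounds_nonneg by (simp add: cubic_error_def)

lemma asymmetry_integrable: "integrable M asymmetry"
  unfolding asymmetry_def[abs_def] using R_diff_integrable by simp

lemma asymmetry_nonneg: "0 \<le> asymmetry \<omega>"
  using bounds_nonneg lam_pos by (simp add: asymmetry_def)

lemma flow_error_integrable: "integrable M flow_error"
  unfolding flow_error_def[abs_def] using asymmetry_integrable cubic_error_integrable by simp

lemma flow_error_nonneg: "0 \<le> flow_error \<omega>"
  using asymmetry_nonneg cubic_error_nonneg by (simp add: flow_error_def)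

lemma abs_remainder_le: "\<bar>remainder \<omega>\<bar> \<le> cubic_error \<omega>"
  unfolding remainder_def cubic_error_def using G f f'_lipschitz by (rule taylor_2_lipschitz)

lemma remainder_integrable: "integrable M remainder"
proof (rule Bochner_Integration.integrable_bound[OF cubic_error_integrable])
  show "AE \<omega> in M. norm (remainder \<omega>) \<le> norm (cubic_error \<omega>)"
    using abs_remainder_le by (auto intro: order_trans[OF _ abs_ge_self])
qed (unfold remainder_def[abs_def], measurable)

lemma G_diff_integrable: "integrable M (\<lambda>\<omega>. G (W' \<omega>) - G (W \<omega>))"
proof (rule Bochner_Integration.integrable_bound)
  show "integrable M (\<lambda>\<omega>. c0 * (W' \<omega> - W \<omega>))"
    using W_diff_integrable by simp
  have "\<bar>G x - G y\<bar> \<le> c0 * \<bar>x - y\<bar>" for x y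
    using field_differentiable_bound[OF convex_UNIV, of G f c0 x y] G f_bound by auto
  then show "AE \<omega> in M. norm (G (W' \<omega>) - G (W \<omega>)) \<le> norm (c0 * (W' \<omega> - W \<omega>))"
    using bounds_nonneg by (simp add: abs_mult)
qed measurable

lemma set_integral_drift:
  assumes s: "s \<in> {1, -1}"
  shows "(LINT \<omega>:level j|M. drift s \<omega>)
    = (LINT \<omega>:level j \<inter> jump s|M. f (W \<omega>) * (W' \<omega> - W \<omega>))
      + (LINT \<omega>:level j \<inter> jump s|M. f' (W \<omega>) * (W' \<omega> - W \<omega>)\<^sup>2) / 2"
proof -
  have Mcond_meas [measurable]: "Mcond M W Y W' Y' l s \<in> borel_measurable M" for l
    unfolding Mcond_def by (rule borel_measurable_cond_exp2)
  have "AE \<omega> in M. drift s \<omega> = f (W \<omega>) * Mcond M W Y W' Y' 1 s \<omega> + f' (W \<omega>) * Mcond M W Y W' Y' 2 s \<omega> / 2"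
    using Mcond_1[OF s] Mcond_2[OF s] by eventually_elim (simp add: drift_def)
  then have "(LINT \<omega>:level j|M. drift s \<omega>)
      = (LINT \<omega>:level j|M. f (W \<omega>) * Mcond M W Y W' Y' 1 s \<omega> + f' (W \<omega>) * Mcond M W Y W' Y' 2 s \<omega> / 2)"
    using drift_integrable[OF s] by (intro set_lebesgue_integral_cong_AE) (auto elim: eventually_mono)
  also have "\<dots> = (LINT \<omega>:level j|M. f (W \<omega>) * Mcond M W Y W' Y' 1 s \<omega>)
      + (LINT \<omega>:level j|M. f' (W \<omega>) * Mcond M W Y W' Y' 2 s \<omega>) / 2"
    using integrable_Mcond[of 1 s] integrable_Mcond[of 2 s] W_diff_integrable W_diff_square_integrable
    by (subst set_integral_add)
       (auto intro!: integrable_imp_set_integrable f_mult_integrable f'_mult_integrable)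
  also have "(LINT \<omega>:level j|M. f (W \<omega>) * Mcond M W Y W' Y' 1 s \<omega>)
      = (LINT \<omega>:level j \<inter> jump s|M. f (W \<omega>) * (W' \<omega> - W \<omega>))"
    using set_integral_Mcond[of 1 f c0 j s] W_diff_integrable f_bound by simp
  also have "(LINT \<omega>:level j|M. f' (W \<omega>) * Mcond M W Y W' Y' 2 s \<omega>)
      = (LINT \<omega>:level j \<inter> jump s|M. f' (W \<omega>) * (W' \<omega> - W \<omega>)\<^sup>2)"
    using set_integral_Mcond[of 2 f' c1 j s] W_diff_square_integrable f'_bound by simp
  finally show ?thesis .
qed

lemma flow_eq_drift_add_remainder:
  assumes s: "s \<in> {1, -1}"
  shows "flow G j s = (LINT \<omega>:level j|M. drift s \<omega>) + (LINT \<omega>:level j \<inter> jump s|M. remainder \<omega>)"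
proof -
  have "flow G j s = (LINT \<omega>:level j \<inter> jump s|M.
      f (W \<omega>) * (W' \<omega> - W \<omega>) + f' (W \<omega>) * (W' \<omega> - W \<omega>)\<^sup>2 / 2 + remainder \<omega>)"
    by (simp add: flow_def remainder_def)
  then show ?thesis
    unfolding set_integral_drift[OF s]
    using W_diff_integrable W_diff_square_integrable remainder_integrable
    by (simp add: integrable_imp_set_integrable f_mult_integrable f'_mult_integrable)
qed

lemma abs_drift_diff_le: "\<bar>drift 1 \<omega> - drift (-1) \<omega>\<bar> \<le> asymmetry \<omega>"
proof -
  let ?d1 = "R1 1 \<omega> - R1 (-1) \<omega>" and ?d2 = "R2 1 \<omega> - R2 (-1) \<omega>"
  have "drift 1 \<omega> - drift (-1) \<omega> = lam * (f' (W \<omega>) / 2 * ?d2 - f (W \<omega>) * ?d1)"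
    by (simp add: drift_def field_simps)
  also have "\<bar>\<dots>\<bar> \<le> lam * (\<bar>f' (W \<omega>)\<bar> / 2 * \<bar>?d2\<bar> + \<bar>f (W \<omega>)\<bar> * \<bar>?d1\<bar>)"
    using abs_triangle_ineq4[of "f' (W \<omega>) / 2 * ?d2" "f (W \<omega>) * ?d1"] lam_pos by (simp add: abs_mult)
  also have "\<dots> \<le> lam * (c1 / 2 * \<bar>?d2\<bar> + c0 * \<bar>?d1\<bar>)"
    using f_bound f'_bound lam_pos by (intro mult_left_mono add_mono mult_right_mono) auto
  finally show ?thesis by (simp add: asymmetry_def add.commute)
qed

lemma abs_flow_diff_le: "\<bar>flow G j 1 - flow G j (-1)\<bar> \<le> (LINT \<omega>:level j|M. flow_error \<omega>)"
proof -
  let ?int = "\<lambda>A g. LINT \<omega>:A|M. g \<omega>" and ?level = "level j"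
  have "\<bar>?int ?level (drift 1) - ?int ?level (drift (-1))\<bar> = \<bar>?int ?level (\<lambda>\<omega>. drift 1 \<omega> - drift (-1) \<omega>)\<bar>"
    using drift_integrable by (simp add: integrable_imp_set_integrable)
  also have "\<dots> \<le> ?int ?level asymmetry"
    using drift_integrable asymmetry_integrable by (intro set_integral_abs_le abs_drift_diff_le) auto
  finally have drift: "\<bar>?int ?level (drift 1) - ?int ?level (drift (-1))\<bar> \<le> ?int ?level asymmetry" .
  have "\<bar>?int (?level \<inter> jump s) remainder\<bar> \<le> ?int (?level \<inter> jump s) cubic_error" for s
    using remainder_integrable cubic_error_integrable by (intro set_integral_abs_le abs_remainder_le) auto
  note this[of 1] this[of "-1"]
  moreover have "?int (?level \<inter> jump 1) cubic_error + ?int (?level \<inter> jump (-1)) cubic_error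
      = ?int (?level \<inter> jump 1 \<union> ?level \<inter> jump (-1)) cubic_error"
    using cubic_error_integrable
    by (intro set_integral_Un[symmetric] integrable_imp_set_integrable) (auto simp: jump_def)
  moreover have "\<dots> \<le> ?int ?level cubic_error"
    using cubic_error_integrable cubic_error_nonneg by (intro set_integral_mono_set) auto
  moreover have "?int ?level flow_error = ?int ?level asymmetry + ?int ?level cubic_error"
    using asymmetry_integrable cubic_error_integrable
    by (simp add: flow_error_def integrable_imp_set_integrable)
  ultimately show ?thesis
    using drift flow_eq_drift_add_remainder[of 1 j] flow_eq_drift_add_remainder[of "-1" j] by simp
qed

lemma abs_flow_le: "\<bar>flow G k (-1)\<bar> \<le> (LINT \<omega>:{\<omega> \<in> space M. Y \<omega> < k}|M. flow_error \<omega>)"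
proof (rule abs_le_set_integral_below[where a = "\<lambda>j. flow G j (-1)",
      OF flow_error_integrable flow_error_nonneg])
  show "\<bar>flow G j (-1)\<bar> \<le> \<bar>flow G (j - 1) (-1)\<bar> + (LINT \<omega>:level (j - 1)|M. flow_error \<omega>)" for j
    using flow_reverse[of G j 1] abs_flow_diff_le[of "j - 1"] by simp
  show "(\<lambda>n. flow G (k - real n) (-1)) \<longlonglongrightarrow> 0"
    using G_diff_integrable by (rule flow_tendsto_0)
qed

lemma abs_set_integral_drift_le: "\<bar>LINT \<omega>:level k|M. drift (-1) \<omega>\<bar> \<le> (\<integral>\<omega>. flow_error \<omega> \<partial>M)"
proof -
  let ?below = "{\<omega> \<in> space M. Y \<omega> < k}"
  note error = flow_error_integrable flow_error_nonneg
  have "\<bar>remainder \<omega>\<bar> \<le> flow_error \<omega>" for \<omega>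
    using abs_remainder_le[of \<omega>] asymmetry_nonneg[of \<omega>] by (simp add: flow_error_def)
  then have "\<bar>LINT \<omega>:level k \<inter> jump (-1)|M. remainder \<omega>\<bar> \<le> (LINT \<omega>:level k \<inter> jump (-1)|M. flow_error \<omega>)"
    using remainder_integrable error(1) by (intro set_integral_abs_le) auto
  also have "\<dots> \<le> (LINT \<omega>:level k|M. flow_error \<omega>)"
    using error by (intro set_integral_mono_set) auto
  finally have "\<bar>LINT \<omega>:level k|M. drift (-1) \<omega>\<bar>
      \<le> (LINT \<omega>:?below|M. flow_error \<omega>) + (LINT \<omega>:level k|M. flow_error \<omega>)"
    using abs_flow_le[of k] flow_eq_drift_add_remainder[of "-1" k] by simp
  also have "\<dots> = (LINT \<omega>:?below \<union> level k|M. flow_error \<omega>)"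
    using error(1) by (intro set_integral_Un[symmetric] integrable_imp_set_integrable) (auto simp: level_def)
  also have "\<dots> \<le> (LINT \<omega>:space M|M. flow_error \<omega>)"
    using error by (intro set_integral_mono_set) (auto simp: level_def)
  finally show ?thesis
    using error(1) by (simp add: set_integral_space)
qed

lemma integral_flow_error:
  "(\<integral>\<omega>. flow_error \<omega> \<partial>M)
    = lam * (c0 * sign_gap R1 + c1 / 2 * sign_gap R2 + c2 / (6 * lam) * third_abs_moment)"
  unfolding flow_error_def asymmetry_def cubic_error_def sign_gap_def third_abs_moment_def
  using R_diff_integrable third_moment lam_pos by (simp add: field_simps)

lemma stein_operator_integrable: "integrable M (stein_operator f f')"
  unfolding stein_operator_def[abs_def]
  using f'_mult_integrable[of "\<lambda>_. 1"] f_mult_integrable[OF W_integrable] by (simp add: mult.commute)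

lemma R_error_integrable:
  assumes "s \<in> {1, -1}"
  shows "integrable M (R_error s)"
  unfolding R_error_def[abs_def] using R_integrable[OF assms]
  by (intro Bochner_Integration.integrable_diff integrable_divide f_mult_integrable f'_mult_integrable)

lemma set_integral_drift_eq_stein_operator:
  assumes s: "s \<in> {1, -1}"
  shows "(LINT \<omega>:level k|M. drift s \<omega>)
    = lam * (psi / 2 * (LINT \<omega>:level k|M. stein_operator f f' \<omega>) - (LINT \<omega>:level k|M. R_error s \<omega>))"
proof -
  have "drift s = (\<lambda>\<omega>. lam * (psi / 2 * stein_operator f f' \<omega> - R_error s \<omega>))"
    by (simp add: fun_eq_iff drift_def stein_operator_def R_error_def field_simps)
  then show ?thesis
    using stein_operator_integrable R_error_integrable[OF s] by (simp add: integrable_imp_set_integrable)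
qed

lemma abs_set_integral_R_error_le:
  assumes s: "s \<in> {1, -1}"
  shows "\<bar>LINT \<omega>:level k|M. R_error s \<omega>\<bar>
    \<le> c0 * (LINT \<omega>:level k|M. \<bar>R1 s \<omega>\<bar>) + c1 / 2 * (LINT \<omega>:level k|M. \<bar>R2 s \<omega>\<bar>)"
proof -
  have "\<bar>LINT \<omega>:level k|M. R_error s \<omega>\<bar> \<le> (LINT \<omega>:level k|M. c0 * \<bar>R1 s \<omega>\<bar> + c1 / 2 * \<bar>R2 s \<omega>\<bar>)"
  proof (rule set_integral_abs_le[OF R_error_integrable[OF s]])
    fix \<omega>
    have "\<bar>f (W \<omega>) * R1 s \<omega>\<bar> \<le> c0 * \<bar>R1 s \<omega>\<bar>" "\<bar>f' (W \<omega>) * R2 s \<omega>\<bar> \<le> c1 * \<bar>R2 s \<omega>\<bar>"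
      using f_bound f'_bound by (auto simp: abs_mult intro: mult_right_mono)
    then show "\<bar>R_error s \<omega>\<bar> \<le> c0 * \<bar>R1 s \<omega>\<bar> + c1 / 2 * \<bar>R2 s \<omega>\<bar>"
      by (simp add: R_error_def)
  qed (use R_integrable[OF s] in auto)
  also have "\<dots> = c0 * (LINT \<omega>:level k|M. \<bar>R1 s \<omega>\<bar>) + c1 / 2 * (LINT \<omega>:level k|M. \<bar>R2 s \<omega>\<bar>)"
    using R_integrable[OF s] by (simp add: integrable_imp_set_integrable)
  finally show ?thesis .
qed

lemma set_integral_stein_operator_le:
  "psi * \<bar>LINT \<omega>:level k|M. stein_operator f f' \<omega>\<bar>
    \<le> 2 * c0 * ((LINT \<omega>:level k|M. \<bar>R1 (-1) \<omega>\<bar>) + sign_gap R1)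
      + c1 * ((LINT \<omega>:level k|M. \<bar>R2 (-1) \<omega>\<bar>) + sign_gap R2)
      + c2 / (3 * lam) * third_abs_moment"
    (is "psi * \<bar>?X\<bar> \<le> 2 * c0 * (?A + ?C) + c1 * (?B + ?D) + c2 / (3 * lam) * ?S")
proof -
  let ?E = "LINT \<omega>:level k|M. R_error (-1) \<omega>"
  have "lam * \<bar>psi / 2 * ?X - ?E\<bar> \<le> lam * (c0 * ?C + c1 / 2 * ?D + c2 / (6 * lam) * ?S)"
    using abs_set_integral_drift_le[of k] set_integral_drift_eq_stein_operator[of "-1" k] lam_pos
    by (simp add: integral_flow_error abs_mult)
  then have drift: "\<bar>psi / 2 * ?X - ?E\<bar> \<le> c0 * ?C + c1 / 2 * ?D + c2 / (6 * lam) * ?S"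
    using lam_pos by simp
  have "psi * \<bar>?X\<bar> = 2 * \<bar>psi / 2 * ?X - ?E + ?E\<bar>"
    using psi_pos by (simp add: abs_mult)
  also have "\<dots> \<le> 2 * (\<bar>psi / 2 * ?X - ?E\<bar> + \<bar>?E\<bar>)"
    by (intro mult_left_mono abs_triangle_ineq) simp
  also have "\<dots> \<le> 2 * ((c0 * ?C + c1 / 2 * ?D + c2 / (6 * lam) * ?S) + (c0 * ?A + c1 / 2 * ?B))"
    by (intro mult_left_mono add_mono drift abs_set_integral_R_error_le) simp_all
  also have "\<dots> = 2 * c0 * (?A + ?C) + c1 * (?B + ?D) + c2 / (3 * lam) * ?S"
    by (simp add: algebra_simps)
  finally show ?thesis .
qed

end

lemma cond_exp_lipschitz_bound:
  assumes lip: "C-lipschitz_on UNIV h" and "0 < measure M (level k)"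
    and third_moment: "integrable M (\<lambda>\<omega>. \<bar>W' \<omega> - W \<omega>\<bar> ^ 3)"
  shows "\<bar>cond_exp_event M (\<lambda>\<omega>. h (W \<omega>)) (level k) - std_normal_mean h\<bar> \<le> C *
    (2 / psi * (cond_exp_event M (\<lambda>\<omega>. \<bar>R1 (-1) \<omega>\<bar>) (level k) + sign_gap R1 / measure M (level k))
      + sqrt (2 / (pi * psi\<^sup>2))
        * (cond_exp_event M (\<lambda>\<omega>. \<bar>R2 (-1) \<omega>\<bar>) (level k) + sign_gap R2 / measure M (level k))
      + 2 / (3 * lam * psi * measure M (level k)) * third_abs_moment)" (is "_ \<le> ?bound")
proof -
  let ?f = "stein_sol h" and ?f' = "stein_sol_deriv h"
  let ?A = "LINT \<omega>:level k|M. \<bar>R1 (-1) \<omega>\<bar>" and ?B = "LINT \<omega>:level k|M. \<bar>R2 (-1) \<omega>\<bar>"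
  define p q where "p = measure M (level k)" and "q = sqrt (2 / (pi * psi\<^sup>2))"
  define X where "X = (LINT \<omega>:level k|M. stein_operator ?f ?f' \<omega>)"
  have p: "0 < p" using assms(2) by (simp add: p_def)
  have q: "sqrt (2 / pi) = psi * q"
    using psi_pos by (simp add: q_def real_sqrt_divide real_sqrt_mult)
  have f: "(?f has_real_derivative ?f' x) (at x)" for x
    using lipschitz_on_continuous_within[OF lip, of x] integrable_std_normal_lipschitz[OF lip]
    by (intro stein_sol_has_derivative) simp_all
  then have "continuous_on UNIV ?f"
    by (auto intro: DERIV_continuous_on)
  then obtain G where G: "\<And>x. (G has_real_derivative ?f x) (at x)"
    by (rule continuous_antiderivative) blast
  have "\<bar>cond_exp_event M (\<lambda>\<omega>. h (W \<omega>)) (level k) - std_normal_mean h\<bar> = psi * \<bar>X\<bar> / (psi * p)"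
    using set_integral_stein_operator_stein_sol[OF integrable_lipschitz_on_compose[OF lip W_integrable], of k]
      p psi_pos by (simp add: cond_exp_event_level X_def p_def[symmetric] field_simps abs_divide)
  also have "\<dots> \<le> (2 * C * (?A + sign_gap R1) + C * sqrt (2 / pi) * (?B + sign_gap R2)
      + 2 * C / (3 * lam) * third_abs_moment) / (psi * p)"
    unfolding X_def using p psi_pos
    by (intro divide_right_mono set_integral_stein_operator_le[OF G f] stein_sol_lipschitz_bounds(1)[OF lip]
        stein_sol_deriv_bound[OF lip] stein_sol_deriv_lipschitz[OF lip] third_moment) simp
  also have "\<dots> = ?bound"
    unfolding cond_exp_event_level p_def[symmetric] q_def[symmetric] q
    using p psi_pos lam_pos by (simp add: field_simps)
  finally show ?thesis .
qed

lemma dW_cond_normal_level_le: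
  assumes p: "0 < measure M (level k)"
  shows "dW_cond_normal M W (level k)
    \<le> ennreal
        (2 / psi * (cond_exp_event M (\<lambda>\<omega>. \<bar>R1 (-1) \<omega>\<bar>) (level k) + sign_gap R1 / measure M (level k))
          + sqrt (2 / (pi * psi\<^sup>2))
            * (cond_exp_event M (\<lambda>\<omega>. \<bar>R2 (-1) \<omega>\<bar>) (level k) + sign_gap R2 / measure M (level k)))
      + ennreal (2 / (3 * lam * psi * measure M (level k))) * (\<integral>\<^sup>+ \<omega>. ennreal (\<bar>W' \<omega> - W \<omega>\<bar> ^ 3) \<partial>M)"
    (is "_ \<le> ennreal ?E + ennreal ?K * ?S")
proof (cases "?S = \<top>")
  case True
  have "0 < ?K" using p lam_pos psi_pos by simp
  then have "ennreal ?K * ?S = \<top>"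
    unfolding True by (simp only: ennreal_mult_top ennreal_eq_0_iff not_le[symmetric] if_False)
  then show ?thesis by simp
next
  case False
  then have third_moment: "integrable M (\<lambda>\<omega>. \<bar>W' \<omega> - W \<omega>\<bar> ^ 3)"
    by (intro integrableI_bounded) (auto simp: top.not_eq_extremum)
  then have S: "?S = ennreal third_abs_moment"
    unfolding third_abs_moment_def by (intro nn_integral_eq_integral) auto
  have nonneg: "0 \<le> ?E" "0 \<le> ?K" "0 \<le> third_abs_moment"
    unfolding cond_exp_event_def sign_gap_def third_abs_moment_def using psi_pos lam_pos
    by (intro add_nonneg_nonneg mult_nonneg_nonneg divide_nonneg_nonneg
        Bochner_Integration.integral_nonneg; simp)+
  have "dW_cond_normal M W (level k) \<le> ennreal (?E + ?K * third_abs_moment)"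
    using cond_exp_lipschitz_bound[OF _ p third_moment, of 1] by (intro dW_cond_normal_leI) simp
  also have "\<dots> = ennreal ?E + ennreal ?K * ?S"
    unfolding S using nonneg by (simp only: ennreal_plus ennreal_mult mult_nonneg_nonneg)
  finally show ?thesis .
qed

end

theorem theorem2p1:
  fixes M :: "'a measure"
    and W Y W' Y' :: "'a \<Rightarrow> real"
    and R0p R0m R1p R1m R2p R2m :: "'a \<Rightarrow> real"
    and zeta lam psi k :: real
  assumes "prob_space M"
    and meas: "W \<in> borel_measurable M" "Y \<in> borel_measurable M"
              "W' \<in> borel_measurable M" "Y' \<in> borel_measurable M"
    \<comment> \<open>(I)\<close>
    and "integrable M W" "integrable M (\<lambda>\<omega>. W \<omega> ^ 2)"
    and "integrable M Y" "integrable M (\<lambda>\<omega>. Y \<omega> ^ 2)"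
    and "prob_space.expectation M W = 0" "prob_space.variance M W = 1"
    and "prob_space.expectation M Y = 0"
    and "prob_space.expectation M (\<lambda>\<omega>. W \<omega> * Y \<omega>) = 0"
    and exch: "distr M borel (\<lambda>\<omega>. (W \<omega>, Y \<omega>, W' \<omega>, Y' \<omega>))
             = distr M borel (\<lambda>\<omega>. (W' \<omega>, Y' \<omega>, W \<omega>, Y \<omega>))"
    \<comment> \<open>(II)\<close>
    and "0 \<le> zeta" "zeta < 1"
    and "AE \<omega> in M. Y \<omega> - zeta \<in> \<int>"
    and "AE \<omega> in M. Y' \<omega> - Y \<omega> \<in> {-1, 0, 1}"
    and "0 < lam" "lam < 1"
    and "R0p \<in> borel_measurable M" "R0m \<in> borel_measurable M"
    and "AE \<omega> in M. Mcond M W Y W' Y' 0 1 \<omega> = lam * prob_space.variance M Y + R0p \<omega>"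
    and "AE \<omega> in M. Mcond M W Y W' Y' 0 (-1) \<omega> = lam * prob_space.variance M Y + R0m \<omega>"
    \<comment> \<open>(III)\<close>
    and "0 < psi"
    and "R1p \<in> borel_measurable M" "R1m \<in> borel_measurable M"
    and "AE \<omega> in M. Mcond M W Y W' Y' 1 1 \<omega> = - lam * (psi * W \<omega> / 2 + R1p \<omega>)"
    and "AE \<omega> in M. Mcond M W Y W' Y' 1 (-1) \<omega> = - lam * (psi * W \<omega> / 2 + R1m \<omega>)"
    \<comment> \<open>(IV)\<close>
    and "R2p \<in> borel_measurable M" "R2m \<in> borel_measurable M"
    and "AE \<omega> in M. Mcond M W Y W' Y' 2 1 \<omega> = lam * (psi + R2p \<omega>)"
    and "AE \<omega> in M. Mcond M W Y W' Y' 2 (-1) \<omega> = lam * (psi + R2m \<omega>)"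
    \<comment> \<open>the value k\<close>
    and pk: "measure M {\<omega> \<in> space M. Y \<omega> = k} > 0"
  shows "let Bk = {\<omega> \<in> space M. Y \<omega> = k};
             p = measure M Bk;
             A = cond_exp_event M (\<lambda>\<omega>. \<bar>R1m \<omega>\<bar>) Bk;
             B = cond_exp_event M (\<lambda>\<omega>. \<bar>R2m \<omega>\<bar>) Bk;
             C = prob_space.expectation M (\<lambda>\<omega>. \<bar>R1p \<omega> - R1m \<omega>\<bar>);
             D = prob_space.expectation M (\<lambda>\<omega>. \<bar>R2p \<omega> - R2m \<omega>\<bar>)
         in dW_cond_normal M W Bk
            \<le> ennreal (2 / psi * (A + C / p) + sqrt (2 / (pi * psi\<^sup>2)) * (B + D / p))
               + ennreal (2 / (3 * lam * psi * p)) * (\<integral>\<^sup>+ \<omega>. ennreal (\<bar>W' \<omega> - W \<omega>\<bar> ^ 3) \<partial>M)"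
proof -
  interpret prob_space M by fact
  interpret stein_pair M W Y W' Y' "\<lambda>s. if s = 1 then R1p else R1m" "\<lambda>s. if s = 1 then R2p else R2m" lam psi
    by unfold_locales (use assms in auto)
  show ?thesis
    using dW_cond_normal_level_le[of k] pk by (simp add: level_def sign_gap_def Let_def)
qed

end
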